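(* Suppose that $X,X_1,X_2,\ldots$ are i.i.d. random variables with mean $0$ and finite variance $\sigma^2$, and let $T_{n,n+k}=\sum_{j=n+1}^{n+k}X_j$. If, for some $p>0$, $$E\,X^2\,\frac{(\log^+|X|)^p}{\log^+\log^+|X|}<\infty,$$ then $$\limsup_{n\to\infty}\frac{T_{n,n+n/(\log n)^p}}{\sqrt{2(p+1)\,\big(n/(\log n)^p\big)\log\log n}}=\sigma\quad\text{a.s.}$$
   Context: Here $\log^+x=\max\{\log x,1\}$ (with $\log^+ 0=1$). Window lengths are rounded to integers: $T_{n,n+a}$ with non-integer $a$ means $T_{n,n+[a]}$, where $[\cdot]$ is the integer part. *)

theory Defs
  imports "HOL-Probability.Probability"
begin

text \<open>
  The positive logarithm truncated below at 1. Since \<^term>\<open>ln 0 = (0::real)\<close>, the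
  convention that its value at 0 is 1 holds automatically; it is only ever applied to
  nonnegative arguments.
\<close>
definition log_plus :: "real \<Rightarrow> real" where
  "log_plus x = max (ln x) 1"

text \<open>
  The window sum over the indices from \<open>n + 1\<close> to \<open>n + [a]\<close>, for a real window length \<open>a\<close>
  that is rounded down to its integer part.
\<close>
definition window_sum :: "(nat \<Rightarrow> 'a \<Rightarrow> real) \<Rightarrow> nat \<Rightarrow> real \<Rightarrow> 'a \<Rightarrow> real" where
  "window_sum X n a \<omega> = (\<Sum>j = n + 1..n + nat \<lfloor>a\<rfloor>. X j \<omega>)"

end

theory Submission
  imports Defs "HOL-Real_Asymp.Real_Asymp"
begin

text \<open>
  Write \<open>a n = n / (ln n)^p\<close> for the window length, \<open>L n = ln (ln n)\<close>, and
  \<open>d n = sqrt (2 (p + 1) (a n) (L n))\<close> for the norming constant. The factor \<open>p + 1\<close> comes from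
  counting: an interval of integers near \<open>n\<close> contains one disjoint window for every \<open>a n\<close>
  integers, so what matters is whether \<open>\<Sum>n. P n / a n\<close> converges, where \<open>P n\<close> is the probability
  that the window sum at \<open>n\<close> exceeds \<open>t * d n\<close>. Gaussian tails give
  \<open>P n = (ln n)^(- (p + 1) t^2 / \<sigma>^2)\<close> up to lower order factors in the exponent, so \<open>P n / a n\<close>
  is about \<open>1 / (n (ln n)^(1 + e))\<close> with \<open>e = (p + 1) (t^2 / \<sigma>^2 - 1)\<close>. The series converges for
  \<open>t > \<sigma>\<close> and diverges for \<open>t < \<sigma>\<close>.

  Upper bound. Variables are truncated at a small multiple of \<open>d n\<close>. The probability that one of
  the variables in the window is larger, divided by \<open>a n\<close>, is summable by the moment hypothesis
  (\<open>moment_weight_ge_linear\<close>, \<open>summable_prob_ge_linear\<close>); for the truncated sum the exponential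
  Markov inequality has the Gaussian rate, since the contribution of intermediate values to the
  moment generating function is at most a small power of \<open>ln n\<close> times a tail of the second moment,
  which decays like a larger negative power of \<open>ln n\<close> (\<open>summable_tail_bound\<close>). Ottaviani's
  inequality transfers the estimate to all windows that start within \<open>\<epsilon> * a n\<close> of \<open>n\<close>. The passage
  to an almost sure statement uses averaging instead of a subsequence: if \<open>E n\<close> is the bad event
  for windows near \<open>n\<close>, then \<open>\<Sum>n. 1 / a n\<close> over those \<open>n\<close> for which \<open>E n\<close> occurs is almost surely
  finite, but a single violation at \<open>k\<close> puts all \<open>n\<close> with \<open>k - \<epsilon> * a k / 2 \<le> n \<le> k\<close> into that sum,
  and these carry weight at least \<open>\<epsilon> / 2\<close> (\<open>window_upper_bound\<close>).

  Lower bound. The window is cut into \<open>q\<close> blocks, with \<open>q\<close> proportional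
  to \<open>L n\<close>, so that each block has to exceed only a fixed multiple \<open>R\<close> of its standard deviation.
  The central limit theorem bounds the probability for one block from below by about
  \<open>exp (- (R + 1)^2 / 2)\<close>, and independence gives its \<open>q\<close>-th power, which has the Gaussian rate as
  \<open>R\<close> grows (\<open>upper_tail_window_ge\<close>). Consecutive disjoint windows are independent, so the second
  Borel-Cantelli lemma yields infinitely many successes (\<open>window_lower_bound\<close>).
\<close>

section \<open>Window lengths, norming constants and the moment weight\<close>

definition window_length :: "real \<Rightarrow> nat \<Rightarrow> real" where
  "window_length p n = real n / ln (real n) powr p"

definition norming :: "real \<Rightarrow> nat \<Rightarrow> real" where
  "norming p n = sqrt (2 * (p + 1) * window_length p n * ln (ln (real n)))"

definition window_size :: "real \<Rightarrow> nat \<Rightarrow> nat" where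
  "window_size p n = nat \<lfloor>window_length p n\<rfloor>"

lemma window_length_nonneg: "window_length p n \<ge> 0"
  by (simp add: window_length_def)

lemma window_size_bounds:
  "real (window_size p n) \<le> window_length p n"
  "window_length p n < real (window_size p n) + 1"
  using window_length_nonneg[of p n] by (simp_all add: window_size_def of_nat_nat)

lemma window_length_at_top: "p > 0 \<Longrightarrow> filterlim (window_length p) at_top at_top"
  unfolding window_length_def by real_asymp

lemma window_length_le: "p > 0 \<Longrightarrow> eventually (\<lambda>n. window_length p n \<le> real n) at_top"
  unfolding window_length_def by real_asymp

lemma norming_at_top: "p > 0 \<Longrightarrow> filterlim (norming p) at_top at_top"
  unfolding norming_def window_length_def by real_asymp

lemma norming_square_over_window_length:
  "p > 0 \<Longrightarrow> filterlim (\<lambda>n. (norming p n)\<^sup>2 / window_length p n) at_top at_top"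
  unfolding norming_def window_length_def by real_asymp

lemma ln_norming_ge:
  "p > 0 \<Longrightarrow> c > 0 \<Longrightarrow> eventually (\<lambda>n. ln (real n) / 4 \<le> ln (c * norming p n)) at_top"
  unfolding norming_def window_length_def by real_asymp

lemma ln_norming_div_ge:
  "p > 0 \<Longrightarrow> c > 0 \<Longrightarrow> eventually (\<lambda>n. ln (real n) / 4 \<le>
      ln (c * norming p n / ln (ln (real n)))) at_top"
  unfolding norming_def window_length_def by real_asymp

lemma norming_le: "p > 0 \<Longrightarrow> c > 0 \<Longrightarrow> eventually (\<lambda>n. c * norming p n \<le> real n) at_top"
  unfolding norming_def window_length_def by real_asymp

lemma norming_squared:
  assumes "p > 0"
  shows "eventually (\<lambda>n. (norming p n)\<^sup>2 =
      2 * (p + 1) * window_length p n * ln (ln (real n))) at_top"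
proof -
  have "eventually (\<lambda>n::nat. ln (ln (real n)) > 0) at_top" by real_asymp
  moreover have "eventually (\<lambda>n. window_length p n > 0) at_top"
    using window_length_at_top[OF assms] by (simp add: filterlim_at_top_dense)
  ultimately show ?thesis
    by eventually_elim (use assms in \<open>simp add: norming_def\<close>)
qed

text \<open>
  The derivative of \<open>x / (ln x)^p\<close> is \<open>(ln x)^(-p) * (1 - p / ln x)\<close>, which lies between 0 and 1
  as soon as \<open>ln x\<close> is at least \<open>max 1 p\<close>. The Lipschitz bound ensures that windows with nearby
  starting points have nearby end points.
\<close>
lemma window_length_mono_lipschitz:
  assumes p: "p > 0"
  shows "\<exists>N. \<forall>n\<ge>N. \<forall>k\<ge>n. window_length p n \<le> window_length p k \<and>
      window_length p k - window_length p n \<le> real k - real n"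
proof -
  define f where "f x = x / ln x powr p" for x :: real
  define f' where "f' x = ln x powr (-p) * (1 - p / ln x)" for x :: real
  define x0 where "x0 = exp (max 1 p)"
  have large: "ln x \<ge> 1 \<and> ln x \<ge> p \<and> x > 0" if "x \<ge> x0" for x
  proof -
    have "x > 0" using that exp_gt_zero[of "max 1 p"] unfolding x0_def by linarith
    moreover from this have "ln x \<ge> max 1 p" using that unfolding x0_def by (subst ln_ge_iff)
    ultimately show ?thesis by auto
  qed
  have der: "(f has_real_derivative f' x) (at x)" if "x \<ge> x0" for x
  proof -
    have *: "ln x > 0" "x > 0" "x > 1" using large[OF that] ln_gt_zero_iff[of x] by linarith+
    have "((\<lambda>x. x * ln x powr (-p)) has_real_derivative f' x) (at x)"
      unfolding f'_def using *
      by (auto intro!: derivative_eq_intros simp: field_simps powr_diff powr_minus)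
    moreover have "f = (\<lambda>x. x * ln x powr (-p))"
      by (auto simp: f_def powr_minus field_simps)
    ultimately show ?thesis by simp
  qed
  have f'01: "0 \<le> f' x" "f' x \<le> 1" if "x \<ge> x0" for x
  proof -
    have *: "ln x \<ge> 1" "ln x \<ge> p" using large[OF that] by auto
    have "ln x powr (-p) \<le> 1"
      using * p
          by (metis ge_one_powr_ge_zero inverse_le_1_iff less_eq_real_def powr_minus powr_ge_zero)
    moreover have "0 \<le> 1 - p / ln x" "1 - p / ln x \<le> 1" using * p by (auto simp: field_simps)
    ultimately show "0 \<le> f' x" "f' x \<le> 1"
      by (auto simp: f'_def intro!: mult_nonneg_nonneg mult_le_one)
  qed
  have "f x \<le> f y \<and> f y - f x \<le> y - x" if "x0 \<le> x" "x \<le> y" for x y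
  proof
    show "f x \<le> f y"
      using that by (intro DERIV_nonneg_imp_nondecreasing[of x y f]) (auto intro!: exI der f'01)
    have "y - f y \<ge> x - f x"
    proof (rule DERIV_nonneg_imp_nondecreasing[of x y "\<lambda>y. y - f y"])
      show "\<exists>d. ((\<lambda>y. y - f y) has_real_derivative d) (at u) \<and> 0 \<le> d" if "x \<le> u" "u \<le> y" for u
        using that \<open>x0 \<le> x\<close> f'01(2)[of u]
        by (intro exI[of _ "1 - f' u"]) (auto intro!: derivative_intros der)
    qed (use that in auto)
    then show "f y - f x \<le> y - x" by simp
  qed
  then have "\<forall>n\<ge>nat \<lceil>x0\<rceil>. \<forall>k\<ge>n. window_length p n \<le> window_length p k \<and>
      window_length p k - window_length p n \<le> real k - real n"
    by (auto simp: window_length_def f_def nat_ceiling_le_eq)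
  then show ?thesis ..
qed

lemma norming_mono:
  assumes p: "p > 0"
  shows "\<exists>N. \<forall>n\<ge>N. \<forall>k\<ge>n. norming p n \<le> norming p k"
proof -
  obtain N where N: "window_length p n \<le> window_length p k" if "n \<ge> N" "k \<ge> n" for n k
    using window_length_mono_lipschitz[OF p] by blast
  have "norming p n \<le> norming p k" if n: "n \<ge> max N 16" and k: "k \<ge> n" for n k
  proof -
    have e: "ln (16::real) \<ge> 1"
      using exp_le by (simp add: ln_ge_iff)
    have "ln (real n) \<ge> ln 16" using n by simp
    then have l: "ln (real n) \<ge> 1" using e by linarith
    moreover have "ln (real k) \<ge> ln (real n)" using n k by simp
    ultimately have "ln (ln (real n)) \<ge> 0" "ln (ln (real k)) \<ge> ln (ln (real n))" by auto
    moreover have "0 \<le> window_length p n" by (simp add: window_length_def)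
    ultimately show ?thesis
      unfolding norming_def using p N[of n k] n k
      by (intro real_sqrt_le_mono mult_mono) auto
  qed
  then show ?thesis by blast
qed

text \<open>
  Up to a constant factor, the terms are dominated by the increments of \<open>- (ln n)^(-e)\<close>, which
  telescope.
\<close>
lemma summable_inverse_n_ln_powr:
  assumes "e > 0"
  shows "summable (\<lambda>n::nat. 1 / (real n * ln (real n) powr (1 + e)))"
proof (rule summable_comparison_test_ev)
  have "eventually (\<lambda>n::nat. 1 / (real n * ln (real n) powr (1 + e)) \<le>
      2 / e * (ln (real n) powr (-e) - ln (real (Suc n)) powr (-e))) at_top"
    using assms by real_asymp
  then show "eventually (\<lambda>n::nat. norm (1 / (real n * ln (real n) powr (1 + e))) \<le>
      2 / e * (ln (real n) powr (-e) - ln (real (Suc n)) powr (-e))) at_top"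
    by eventually_elim simp
  have "(\<lambda>n::nat. ln (real n) powr (-e)) \<longlonglongrightarrow> 0" using assms by real_asymp
  from telescope_summable'[OF this]
  show "summable (\<lambda>n::nat. 2 / e * (ln (real n) powr (-e) - ln (real (Suc n)) powr (-e)))"
    by (intro summable_mult)
qed

text \<open>
  The terms dominate half the increments of \<open>ln (ln n)\<close>, which is unbounded.
\<close>
lemma not_summable_inverse_n_ln: "\<not> summable (\<lambda>n::nat. 1 / (real n * ln (real n)))"
proof
  assume *: "summable (\<lambda>n::nat. 1 / (real n * ln (real n)))"
  have "eventually (\<lambda>n::nat. ln (ln (real (Suc n))) - ln (ln (real n)) \<le>
      2 * (1 / (real n * ln (real n)))) at_top"
    by real_asymp
  moreover have "eventually (\<lambda>n::nat. ln (ln (real (Suc n))) - ln (ln (real n)) \<ge> 0) at_top"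
    by real_asymp
  ultimately have "eventually (\<lambda>n::nat. norm (ln (ln (real (Suc n))) - ln (ln (real n))) \<le>
      2 * (1 / (real n * ln (real n)))) at_top"
    by eventually_elim simp
  then have "summable (\<lambda>n::nat. ln (ln (real (Suc n))) - ln (ln (real n)))"
    by (rule summable_comparison_test_ev) (intro summable_mult *)
  then have "convergent (\<lambda>n. \<Sum>i<n. ln (ln (real (Suc i))) - ln (ln (real i)))"
    by (simp only: summable_iff_convergent)
  then have "convergent (\<lambda>n. ln (ln (real n)) - ln (ln (real 0)))"
    by (simp only: sum_lessThan_telescope[of "\<lambda>i. ln (ln (real i))"])
  then obtain l where "(\<lambda>n. ln (ln (real n)) - ln (ln (real 0))) \<longlonglongrightarrow> l"
    by (auto simp: convergent_def)
  moreover have "filterlim (\<lambda>n::nat. ln (ln (real n)) - ln (ln (real 0))) at_top at_top"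
    by real_asymp
  ultimately show False
    using not_tendsto_and_filterlim_at_infinity[of sequentially] filterlim_at_top_imp_at_infinity
    by (metis trivial_limit_sequentially)
qed

lemma ln_le_scaled_ln:
  fixes y z :: real
  assumes "1 \<le> ln z" "0 < z" "z \<le> y"
  shows "ln y \<le> y / z * ln z"
proof -
  have "ln y - ln z = ln (y / z)" using assms by (simp add: ln_div)
  also have "\<dots> \<le> y / z - 1" using assms by (intro ln_le_minus_one) auto
  also have "\<dots> \<le> (y / z - 1) * ln z"
    using assms mult_left_mono[of 1 "ln z" "y / z - 1"] by (simp add: field_simps)
  finally show ?thesis by (simp add: algebra_simps)
qed

text \<open>
  The random variable whose integrability is the moment hypothesis of the theorem, as a function
  of the value of \<open>X\<close>.
\<close>
definition moment_weight :: "real \<Rightarrow> real \<Rightarrow> real" where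
  "moment_weight p y = y\<^sup>2 * (log_plus \<bar>y\<bar> powr p / log_plus (log_plus \<bar>y\<bar>))"

lemma moment_weight_nonneg: "moment_weight p y \<ge> 0"
  by (auto simp: moment_weight_def log_plus_def)

text \<open>
  This is how the moment hypothesis enters. Up to constants, the square of \<open>norming p n\<close> is
  \<open>n * ln (ln n) / (ln n)^p\<close>, and the weight multiplies it by a factor comparable with
  \<open>(ln n)^p / ln (ln n)\<close>; so a value beyond \<open>\<eta> * norming p n\<close> has weight of order at least \<open>n\<close>.
\<close>
lemma moment_weight_ge_linear:
  assumes p: "p > 0" and \<eta>: "\<eta> > 0"
  shows "\<exists>c>0. eventually (\<lambda>n. \<forall>y. \<bar>y\<bar> > \<eta> * norming p n \<longrightarrow> c * real n \<le> moment_weight p y) at_top"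
proof (intro exI conjI)
  define c where "c = \<eta>\<^sup>2 * (2 * (p + 1)) * (1/4) powr p"
  show "c > 0" using p \<eta> by (simp add: c_def)
  have "filterlim (\<lambda>n. \<eta> * norming p n) at_top at_top"
    using norming_at_top[OF p] \<eta>
        by (rule filterlim_tendsto_pos_mult_at_top[OF tendsto_const _, rotated])
  then have "eventually (\<lambda>n. \<eta> * norming p n \<ge> exp (exp 1)) at_top"
    by (simp add: filterlim_at_top)
  moreover have "eventually (\<lambda>n::nat. real n \<ge> 1) at_top" by real_asymp
  ultimately
  show "eventually (\<lambda>n. \<forall>y. \<bar>y\<bar> > \<eta> * norming p n \<longrightarrow> c * real n \<le> moment_weight p y) at_top"
    using ln_norming_ge[OF p \<eta>] norming_le[OF p \<eta>] norming_squared[OF p]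
  proof eventually_elim
    case (elim n)
    define z where "z = \<eta> * norming p n"
    have z0: "exp (exp 1) \<le> z" using elim(1) by (simp add: z_def)
    then have "z > 0" using exp_gt_zero[of "exp (1::real)"] by linarith
    then have z: "z > 0" "ln z \<ge> exp 1" using z0 by (simp_all add: ln_ge_iff)
    have lz: "ln z > 0" "ln z > 1" using z(2) exp_ge_add_one_self[of 1] by linarith+
    have llz: "ln (ln z) \<ge> 1" using z(2) lz by (simp add: ln_ge_iff)
    have lzn: "ln z \<ge> ln (real n) / 4" "z \<le> real n" using elim by (simp_all add: z_def)
    have ln_n: "ln z \<le> ln (real n)" using z lzn by simp
    then have lln: "ln (ln z) \<le> ln (ln (real n))" using lz by simp
    show ?case
    proof (intro allI impI)
      fix y :: real assume "\<bar>y\<bar> > \<eta> * norming p n"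
      define v where "v = \<bar>y\<bar>"
      have v: "v > z" using \<open>\<bar>y\<bar> > _\<close> by (simp add: z_def v_def)
      have lv: "ln v \<ge> ln z" using v z by simp
      then have llv: "ln (ln v) \<ge> ln (ln z)" using lz by simp
      \<comment> \<open>The function \<open>v^2 / ln (ln v)\<close> is increasing: each logarithm costs at most the factor
        \<open>v / z\<close>.\<close>
      have "ln (ln v) \<le> ln v / ln z * ln (ln z)"
        using lz llz lv by (intro ln_le_scaled_ln) auto
      also have "\<dots> \<le> (v / z) * ln (ln z)"
        using ln_le_scaled_ln[of z v] lz z v llz by (intro mult_right_mono) (auto simp: field_simps)
      also have "\<dots> \<le> (v / z)\<^sup>2 * ln (ln z)"
        using v z llz by (intro mult_right_mono self_le_power) (auto simp: field_simps)
      finally have main: "z\<^sup>2 * ln (ln v) \<le> v\<^sup>2 * ln (ln z)"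
        using z by (simp add: field_simps)
      have "moment_weight p y = v\<^sup>2 * (ln v powr p / ln (ln v))"
      proof -
        have "log_plus v = ln v" using lv lz by (simp add: log_plus_def)
        moreover have "log_plus (ln v) = ln (ln v)" using llv llz by (simp add: log_plus_def)
        moreover have "y\<^sup>2 = v\<^sup>2" by (simp add: v_def)
        ultimately show ?thesis by (simp add: moment_weight_def v_def[symmetric])
      qed
      also have "\<dots> \<ge> z\<^sup>2 / ln (ln z) * (ln v powr p)"
      proof -
        have "z\<^sup>2 / ln (ln z) \<le> v\<^sup>2 / ln (ln v)" using main llz llv by (simp add: field_simps)
        from mult_right_mono[OF this, of "ln v powr p"] show ?thesis by simp
      qed
      finally have 1: "moment_weight p y \<ge> z\<^sup>2 / ln (ln z) * (ln v powr p)" .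
      have "z\<^sup>2 / ln (ln (real n)) * (ln (real n) / 4) powr p \<le> z\<^sup>2 / ln (ln z) * (ln v powr p)"
        using lln llz lzn lv ln_n lz p
        by (intro mult_mono divide_left_mono powr_mono2 divide_nonneg_nonneg mult_pos_pos) auto
      moreover have "z\<^sup>2 / ln (ln (real n)) * (ln (real n) / 4) powr p = c * real n"
      proof -
        have "ln (ln (real n)) \<noteq> 0" "ln (real n) > 0" using lln llz lz ln_n by auto
        then show ?thesis
          using elim(5) lzn
              by (simp add: z_def power_mult_distrib c_def window_length_def powr_divide
                field_simps)
      qed
      ultimately show "c * real n \<le> moment_weight p y" using 1 by linarith
    qed
  qed
qed

text \<open>
  A slightly weaker moment without the iterated logarithm. Any exponent strictly between \<open>p / 2\<close>
  and \<open>p\<close> would serve: it has to beat the factor \<open>(ln n)^(p / 2)\<close> that the exponential moment of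
  the intermediate values produces.
\<close>
lemma moment_weight_ge_power:
  assumes p: "p > 0"
  shows "\<exists>K>0. \<forall>y. y\<^sup>2 * log_plus \<bar>y\<bar> powr (3 * p / 4) \<le> K * moment_weight p y"
proof (intro exI conjI allI)
  define K where "K = max 1 (4 / p)"
  show "K > 0" by (simp add: K_def)
  fix y :: real
  define u where "u = log_plus \<bar>y\<bar>"
  have u: "u \<ge> 1" by (simp add: u_def log_plus_def)
  have "ln u = (4 / p) * ln (u powr (p / 4))" using u p by (simp add: ln_powr)
  also have "\<dots> \<le> (4 / p) * u powr (p / 4)"
    using p u ln_le_minus_one[of "u powr (p/4)"] by (intro mult_left_mono) auto
  also have "\<dots> \<le> K * u powr (p / 4)" by (intro mult_right_mono) (auto simp: K_def)
  finally have "ln u \<le> K * u powr (p / 4)" .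
  moreover have "1 \<le> K * u powr (p / 4)"
    using mult_mono[of 1 K 1 "u powr (p/4)"] u p by (simp add: K_def ge_one_powr_ge_zero)
  ultimately have lu: "log_plus u \<le> K * u powr (p / 4)" by (simp add: log_plus_def)
  have lu0: "log_plus u > 0" by (simp add: log_plus_def less_max_iff_disj)
  have "u powr (3 * p / 4) * log_plus u \<le> u powr (3 * p / 4) * (K * u powr (p / 4))"
    by (intro mult_left_mono lu) auto
  also have "\<dots> = K * u powr p"
    using u by (simp add: powr_add[symmetric] field_simps)
  finally have "u powr (3 * p / 4) \<le> K * (u powr p / log_plus u)"
    using lu0 by (simp add: field_simps)
  from mult_left_mono[OF this, of "y\<^sup>2"]
  show "y\<^sup>2 * log_plus \<bar>y\<bar> powr (3 * p / 4) \<le> K * moment_weight p y"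
    by (simp add: moment_weight_def u_def[symmetric] mult_ac)
qed

lemma chernoff_remainder_tendsto_0:
  assumes "p > 0"
  shows "(\<lambda>n. ln (ln (real n)) * ln (real n) powr (p / 2) * (ln (real n) / 4) powr
      (- (3 * p / 4))) \<longlonglongrightarrow> 0"
  using assms by real_asymp

section \<open>Independent identically distributed sequences\<close>

text \<open>
  All moment conditions are put on the common law \<open>D\<close>, so that one-variable integrals do not
  depend on an index. Indices start at 0, which makes the windows half-open intervals
  \<open>{n..<n + m}\<close>.
\<close>
locale iid_sequence = prob_space M for M :: "'a measure" +
  fixes Z :: "nat \<Rightarrow> 'a \<Rightarrow> real" and D :: "real measure" and \<sigma> :: real
  assumes indep: "indep_vars (\<lambda>_. borel) Z UNIV"
    and distr_Z: "\<And>n. distr M borel (Z n) = D"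
    and square_integrable: "integrable D (\<lambda>x. x\<^sup>2)"
    and mean_zero: "(\<integral>x. x \<partial>D) = 0"
    and variance: "(\<integral>x. x\<^sup>2 \<partial>D) = \<sigma>\<^sup>2"
begin

lemma Z_measurable [measurable]: "Z n \<in> borel_measurable M"
  using indep by (auto simp: indep_vars_def)

sublocale D: prob_space D
  using prob_space_distr[OF Z_measurable, of 0] by (simp add: distr_Z)

lemma D_sets [simp, measurable_cong]: "sets D = sets borel"
  using distr_Z[of 0] by (metis sets_distr)

lemma D_space [simp]: "space D = UNIV"
  using sets_eq_imp_space_eq[OF D_sets] by simp

lemma integrable_D_Z_iff:
  assumes [measurable]: "f \<in> borel_measurable borel"
  shows "integrable M (\<lambda>\<omega>. f (Z n \<omega>) :: real) \<longleftrightarrow> integrable D f"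
  using integrable_distr_eq[OF Z_measurable, of f n] by (simp add: distr_Z)

lemma expectation_Z:
  assumes [measurable]: "f \<in> borel_measurable borel"
  shows "expectation (\<lambda>\<omega>. f (Z n \<omega>) :: real) = (\<integral>x. f x \<partial>D)"
  using integral_distr[OF Z_measurable, of f n] by (simp add: distr_Z)

lemma prob_Z:
  assumes [measurable]: "Measurable.pred borel P"
  shows "prob {\<omega> \<in> space M. P (Z n \<omega>)} = D.prob {x. P x}"
  using measure_distr[OF Z_measurable[of n], of "{x. P x}"]
  by (simp add: distr_Z vimage_def Int_def conj_commute)

lemma integrable_id_D: "integrable D (\<lambda>x. x)"
  by (rule D.square_integrable_imp_integrable) (use square_integrable in auto)

lemma indep_Z: "indep_vars (\<lambda>_. borel) Z I"
  by (rule indep_vars_subset[OF indep]) auto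

text \<open>
  The predicates are applied to restricted sequences because each of them has to be measurable on
  the product space over its own group of indices.
\<close>
lemma prob_disjoint_windows:
  assumes AB: "A \<inter> B = {}"
    and [measurable]: "Measurable.pred (PiM A (\<lambda>_. borel)) P"
        "Measurable.pred (PiM B (\<lambda>_. borel)) Q"
  shows "prob {\<omega> \<in> space M. P (\<lambda>i\<in>A. Z i \<omega>) \<and> Q (\<lambda>i\<in>B. Z i \<omega>)} =
    prob {\<omega> \<in> space M. P (\<lambda>i\<in>A. Z i \<omega>)} * prob {\<omega> \<in> space M. Q (\<lambda>i\<in>B. Z i \<omega>)}"
proof -
  have sp: "(\<lambda>i\<in>C. Z i \<omega>) \<in> space (PiM C (\<lambda>_. borel))" for C \<omega>
    by (simp add: space_PiM)
  have "prob ((\<lambda>\<omega>. (\<lambda>i\<in>A. Z i \<omega>, \<lambda>i\<in>B. Z i \<omega>)) -`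
      ({f \<in> space (PiM A (\<lambda>_. borel)). P f} \<times> {f \<in> space (PiM B (\<lambda>_. borel)). Q f}) \<inter> space M) =
    prob ((\<lambda>\<omega>. \<lambda>i\<in>A. Z i \<omega>) -` {f \<in> space (PiM A (\<lambda>_. borel)). P f} \<inter> space M) *
    prob ((\<lambda>\<omega>. \<lambda>i\<in>B. Z i \<omega>) -` {f \<in> space (PiM B (\<lambda>_. borel)). Q f} \<inter> space M)"
    by (intro indep_varD[OF indep_var_restrict[OF indep AB]]) auto
  then show ?thesis
    by (simp add: vimage_def Int_def sp conj_commute)
qed

lemma second_moment_sum:
  assumes "finite J"
  shows "integrable M (\<lambda>\<omega>. (\<Sum>i\<in>J. Z i \<omega>)\<^sup>2) \<and>
    expectation (\<lambda>\<omega>. (\<Sum>i\<in>J. Z i \<omega>)\<^sup>2) = real (card J) * \<sigma>\<^sup>2"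
  using assms
proof (induction J rule: finite_induct)
  case empty
  then show ?case by simp
next
  case (insert i J)
  let ?S = "\<lambda>\<omega>. \<Sum>i\<in>J. Z i \<omega>"
  have iS2: "integrable M (\<lambda>\<omega>. (?S \<omega>)\<^sup>2)" and ES2: "expectation (\<lambda>\<omega>. (?S \<omega>)\<^sup>2) =
      real (card J) * \<sigma>\<^sup>2"
    using insert.IH by blast+
  have iS: "integrable M ?S"
    by (rule square_integrable_imp_integrable[OF _ iS2]) simp
  have iZ: "integrable M (Z i)"
    by (rule integrable_D_Z_iff[of "\<lambda>x. x", THEN iffD2, OF _ integrable_id_D]) measurable
  have iZ2: "integrable M (\<lambda>\<omega>. (Z i \<omega>)\<^sup>2)"
    using integrable_D_Z_iff[of "\<lambda>x. x\<^sup>2" i] square_integrable by simp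
  have EZ2: "expectation (\<lambda>\<omega>. (Z i \<omega>)\<^sup>2) = \<sigma>\<^sup>2"
    using expectation_Z[of "\<lambda>x. x\<^sup>2" i] variance by simp
  have ind: "indep_var borel (Z i) borel ?S"
    using insert.hyps by (intro indep_vars_sum indep_Z)
  have iZS: "integrable M (\<lambda>\<omega>. Z i \<omega> * ?S \<omega>)"
    by (rule indep_var_integrable[OF ind iZ iS])
  have EZS: "expectation (\<lambda>\<omega>. Z i \<omega> * ?S \<omega>) = 0"
    using indep_var_lebesgue_integral[OF ind iZ iS] expectation_Z[of "\<lambda>x. x" i] mean_zero by simp
  have eq: "(\<lambda>\<omega>. (\<Sum>i\<in>insert i J. Z i \<omega>)\<^sup>2) = (\<lambda>\<omega>. (Z i \<omega>)\<^sup>2 + (2 * (Z i \<omega> * ?S \<omega>) + (?S \<omega>)\<^sup>2))"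
    using insert.hyps by (simp add: power2_sum mult.assoc add_ac)
  have "integrable M (\<lambda>\<omega>. (\<Sum>i\<in>insert i J. Z i \<omega>)\<^sup>2)"
    unfolding eq by (intro Bochner_Integration.integrable_add integrable_mult_right iZ2 iZS iS2)
  moreover have "expectation (\<lambda>\<omega>. (\<Sum>i\<in>insert i J. Z i \<omega>)\<^sup>2) = real (card (insert i J)) * \<sigma>\<^sup>2"
    unfolding eq using insert.hyps
    by (simp add: EZ2 EZS ES2 iZ2 iZS iS2 ring_distribs)
  ultimately show ?case ..
qed

lemma chebyshev_sum:
  assumes "finite J" "x > 0"
  shows "prob {\<omega> \<in> space M. \<bar>\<Sum>i\<in>J. Z i \<omega>\<bar> \<ge> x} \<le> real (card J) * \<sigma>\<^sup>2 / x\<^sup>2"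
  using second_moment_method[of "\<lambda>\<omega>. \<Sum>i\<in>J. Z i \<omega>" x]
    second_moment_sum[OF assms(1)] assms
  by simp

text \<open>
  Ottaviani's maximal inequality. Split by the first time \<open>j\<close> at which the partial sum leaves
  \<open>[- 2 x, 2 x]\<close>. The increment from time \<open>j\<close> to time \<open>m\<close> is independent of that event and by
  Chebyshev's inequality stays below \<open>x\<close> with probability at least one half; if it does, then the
  final sum still exceeds \<open>x\<close> in absolute value.
\<close>
lemma ottaviani:
  assumes x: "x > 0" and m: "2 * (real m * \<sigma>\<^sup>2) \<le> x\<^sup>2"
  shows "prob {\<omega> \<in> space M. \<exists>j\<le>m. \<bar>\<Sum>i\<in>{n..<n+j}. Z i \<omega>\<bar> > 2 * x} \<le>
    2 * prob {\<omega> \<in> space M. \<bar>\<Sum>i\<in>{n..<n+m}. Z i \<omega>\<bar> > x}"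
proof -
  define S where "S j f = (\<Sum>i\<in>{n..<n+j}. f i)" for j and f :: "nat \<Rightarrow> real"
  define R where "R j f = (\<Sum>i\<in>{n+j..<n+m}. f i)" for j and f :: "nat \<Rightarrow> real"
  define P where "P j f \<longleftrightarrow> \<bar>S j f\<bar> > 2 * x \<and> (\<forall>i<j. \<bar>S i f\<bar> \<le> 2 * x)" for j f
  define Q where "Q j f \<longleftrightarrow> \<bar>R j f\<bar> < x" for j f
  let ?Z = "\<lambda>\<omega> i. Z i \<omega>"
  have split: "S m f = S j f + R j f" if "j \<le> m" for j f
    using that by (simp add: S_def R_def sum.atLeastLessThan_concat)
  have [measurable]: "Measurable.pred M (\<lambda>\<omega>. P j (?Z \<omega>))" "Measurable.pred M (\<lambda>\<omega>. Q j (?Z \<omega>))" for j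
    unfolding P_def Q_def S_def R_def by measurable
  have half: "prob {\<omega> \<in> space M. P j (?Z \<omega>)} \<le> 2 * prob {\<omega> \<in> space M. P j (?Z \<omega>) \<and> Q j (?Z \<omega>)}"
    if j: "j \<le> m" for j
  proof -
    let ?A = "{n..<n+j}" and ?B = "{n+j..<n+m}"
    have [measurable]: "Measurable.pred (PiM ?A (\<lambda>_. borel)) (P j)"
    proof -
      have "S i \<in> borel_measurable (PiM ?A (\<lambda>_. borel))" if "i \<le> j" for i
        unfolding S_def using that
            by (intro borel_measurable_sum measurable_component_singleton) auto
      note [measurable] = this[OF order_refl] this[OF less_imp_le]
      show ?thesis unfolding P_def by measurable
    qed
    have [measurable]: "Measurable.pred (PiM ?B (\<lambda>_. borel)) (Q j)"
      unfolding Q_def R_def by measurable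
    have P_restr: "P j (\<lambda>i\<in>?A. Z i \<omega>) = P j (?Z \<omega>)" for \<omega>
      by (auto simp: P_def S_def intro!: arg_cong2[of _ _ _ _ "(\<and>)"] all_cong)
    have Q_restr: "Q j (\<lambda>i\<in>?B. Z i \<omega>) = Q j (?Z \<omega>)" for \<omega>
      by (auto simp: Q_def R_def)
    have prod: "prob {\<omega> \<in> space M. P j (?Z \<omega>) \<and> Q j (?Z \<omega>)} =
      prob {\<omega> \<in> space M. P j (?Z \<omega>)} * prob {\<omega> \<in> space M. Q j (?Z \<omega>)}"
      using prob_disjoint_windows[of ?A ?B "P j" "Q j"] unfolding P_restr Q_restr by auto
    have "prob {\<omega> \<in> space M. \<not> Q j (?Z \<omega>)} \<le> real (card ?B) * \<sigma>\<^sup>2 / x\<^sup>2"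
      using chebyshev_sum[of ?B x] x by (simp add: Q_def R_def not_less)
    also have "\<dots> \<le> real m * \<sigma>\<^sup>2 / x\<^sup>2"
      by (intro divide_right_mono mult_right_mono) auto
    also have "\<dots> \<le> 1 / 2" using m x by (simp add: field_simps)
    finally have "prob {\<omega> \<in> space M. Q j (?Z \<omega>)} \<ge> 1 / 2"
      by (subst (asm) prob_neg) auto
    then show ?thesis
      unfolding prod
          using mult_left_mono[of "1/2" "prob {\<omega> \<in> space M. Q j (?Z \<omega>)}"
              "prob {\<omega> \<in> space M. P j (?Z \<omega>)}"]
      by simp
  qed
  have first: "(\<exists>j\<le>m. \<bar>S j f\<bar> > 2 * x) \<longleftrightarrow> (\<exists>j\<le>m. P j f)" for f
  proof
    assume "\<exists>j\<le>m. \<bar>S j f\<bar> > 2 * x"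
    then obtain j where j: "j \<le> m" "\<bar>S j f\<bar> > 2 * x" by auto
    define k where "k = (LEAST k. \<bar>S k f\<bar> > 2 * x)"
    have "\<bar>S k f\<bar> > 2 * x" "k \<le> j"
      unfolding k_def using j(2) by (auto intro: LeastI Least_le)
    moreover have "\<bar>S i f\<bar> \<le> 2 * x" if "i < k" for i
      using not_less_Least[OF that[unfolded k_def]] by simp
    ultimately show "\<exists>j\<le>m. P j f" using j(1) by (auto simp: P_def intro!: exI[of _ k])
  qed (auto simp: P_def)
  have "prob {\<omega> \<in> space M. \<exists>j\<le>m. \<bar>S j (?Z \<omega>)\<bar> > 2 * x} = prob (\<Union>j\<in>{..m}. {\<omega> \<in> space M. P j (?Z \<omega>)})"
    unfolding first by (intro arg_cong[where f=prob]) auto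
  also have "\<dots> \<le> (\<Sum>j\<in>{..m}. prob {\<omega> \<in> space M. P j (?Z \<omega>)})"
    by (intro finite_measure_subadditive_finite) auto
  also have "\<dots> \<le> (\<Sum>j\<in>{..m}. 2 * prob {\<omega> \<in> space M. P j (?Z \<omega>) \<and> Q j (?Z \<omega>)})"
    by (intro sum_mono half) auto
  also have "\<dots> = 2 * prob (\<Union>j\<in>{..m}. {\<omega> \<in> space M. P j (?Z \<omega>) \<and> Q j (?Z \<omega>)})"
  proof -
    have "disjoint_family_on (\<lambda>j. {\<omega> \<in> space M. P j (?Z \<omega>) \<and> Q j (?Z \<omega>)}) {..m}"
      unfolding disjoint_family_on_def P_def by (force elim: nat_neq_iff[THEN iffD1, elim_format])
    then show ?thesis
      by (subst finite_measure_finite_Union) (auto simp: sum_distrib_left)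
  qed
  also have "\<dots> \<le> 2 * prob {\<omega> \<in> space M. \<bar>S m (?Z \<omega>)\<bar> > x}"
  proof (intro mult_left_mono finite_measure_mono)
    show "{\<omega> \<in> space M. \<bar>S m (?Z \<omega>)\<bar> > x} \<in> events"
      unfolding S_def by measurable
  qed (auto simp: P_def Q_def split)
  finally show ?thesis by (simp add: S_def)
qed

end

section \<open>Exponential bounds for truncated sums\<close>

lemma exp_le_quadratic:
  fixes y :: real
  shows "exp y \<le> 1 + y + y\<^sup>2 / 2 * exp \<bar>y\<bar>"
proof -
  obtain t where t: "\<bar>t\<bar> \<le> \<bar>y\<bar>" "exp y = (\<Sum>m<2. y ^ m / fact m) + exp t / fact 2 * y ^ 2"
    using Maclaurin_exp_le[of y 2] by blast
  have "exp t * y\<^sup>2 \<le> exp \<bar>y\<bar> * y\<^sup>2"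
    using t(1) by (intro mult_right_mono) auto
  then show ?thesis
    using t(2) by (simp add: lessThan_nat_numeral field_simps)
qed

definition trunc :: "real \<Rightarrow> real \<Rightarrow> real" where
  "trunc z x = (if \<bar>x\<bar> \<le> z then x else 0)"

lemma trunc_measurable [measurable]: "trunc z \<in> borel_measurable borel"
  unfolding trunc_def by measurable

lemma log_plus_measurable [measurable]: "log_plus \<in> borel_measurable borel"
  unfolding log_plus_def by measurable

lemma moment_weight_measurable [measurable]: "moment_weight p \<in> borel_measurable borel"
  unfolding moment_weight_def by measurable

context iid_sequence
begin

definition tail_moment :: "real \<Rightarrow> real" where
  "tail_moment b = (\<integral>x. x\<^sup>2 * indicator {x. \<bar>x\<bar> > b} x \<partial>D)"

lemma integrable_tail_moment: "integrable D (\<lambda>x. x\<^sup>2 * indicator {x. \<bar>x\<bar> > b} x)"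
  by (rule Bochner_Integration.integrable_bound[OF square_integrable])
    (auto simp: indicator_def abs_mult)

lemma tail_moment_nonneg: "tail_moment b \<ge> 0"
  unfolding tail_moment_def by (rule integral_nonneg_AE) auto

text \<open>
  The second order expansion of the exponential function is used with two remainders: below the
  lower level \<open>b\<close> the factor \<open>exp (\<bar>c\<bar> * b)\<close> is near 1 for a suitable \<open>b\<close> and leaves the
  variance; between \<open>b\<close> and the truncation level \<open>z\<close> the crude factor \<open>exp (\<bar>c\<bar> * z)\<close> is
  compensated by the small second moment beyond \<open>b\<close>. The first order term accounts for the mean of
  the truncated variable, which is only the tail of a centred one.
\<close>
lemma trunc_mgf_bound:
  assumes z: "z > 0"
  shows "integrable D (\<lambda>x. exp (c * trunc z x))"
    and "(\<integral>x. exp (c * trunc z x) \<partial>D) \<le>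
      1 + (\<bar>c\<bar> / z * tail_moment z + c\<^sup>2 / 2 * (exp (\<bar>c\<bar> * b) * \<sigma>\<^sup>2 + exp (\<bar>c\<bar> * z) *
          tail_moment b))"
proof -
  have bound: "\<bar>c * trunc z x\<bar> \<le> \<bar>c\<bar> * z" for x
    using z by (auto simp: trunc_def abs_mult intro!: mult_left_mono)
  show int: "integrable D (\<lambda>x. exp (c * trunc z x))"
  proof (rule D.integrable_const_bound)
    show "AE x in D. norm (exp (c * trunc z x)) \<le> exp (\<bar>c\<bar> * z)"
      using bound by (auto intro: order.trans[OF abs_ge_self])
  qed measurable
  let ?I = "\<lambda>b x :: real. x\<^sup>2 * indicator {x. \<bar>x\<bar> > b} x"
  let ?g = "\<lambda>x. 1 + (c * x + (\<bar>c\<bar> / z * ?I z x + c\<^sup>2 / 2 * (exp (\<bar>c\<bar> * b) * x\<^sup>2 + exp (\<bar>c\<bar> * z) *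
      ?I b x)))"
  have le: "exp (c * trunc z x) \<le> ?g x" for x
  proof -
    have "c * trunc z x \<le> c * x + \<bar>c\<bar> / z * ?I z x"
    proof (cases "\<bar>x\<bar> \<le> z")
      case False
      have "- (c * x) \<le> \<bar>c\<bar> * \<bar>x\<bar>" by (simp add: abs_mult[symmetric])
      also have "\<dots> \<le> \<bar>c\<bar> * (\<bar>x\<bar> * (\<bar>x\<bar> / z))"
      proof (rule mult_left_mono)
        have "1 \<le> \<bar>x\<bar> / z" using False z by simp
        from mult_left_mono[OF this, of "\<bar>x\<bar>"] show "\<bar>x\<bar> \<le> \<bar>x\<bar> * (\<bar>x\<bar> / z)" by simp
      qed simp
      also have "\<dots> = \<bar>c\<bar> / z * ?I z x" using False by (simp add: power2_eq_square)
      finally show ?thesis using False by (simp add: trunc_def)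
    qed (simp add: trunc_def)
    moreover have "(c * trunc z x)\<^sup>2 / 2 * exp \<bar>c * trunc z x\<bar> \<le>
      c\<^sup>2 / 2 * (exp (\<bar>c\<bar> * b) * x\<^sup>2 + exp (\<bar>c\<bar> * z) * ?I b x)"
    proof -
      have "(trunc z x)\<^sup>2 * exp \<bar>c * trunc z x\<bar> \<le> exp (\<bar>c\<bar> * b) * x\<^sup>2 + exp (\<bar>c\<bar> * z) * ?I b x"
      proof (cases "\<bar>x\<bar> \<le> z")
        case True
        show ?thesis
        proof (cases "\<bar>x\<bar> \<le> b")
          case True
          then have "x\<^sup>2 * exp (\<bar>c\<bar> * \<bar>x\<bar>) \<le> x\<^sup>2 * exp (\<bar>c\<bar> * b)"
            by (intro mult_left_mono) (auto intro!: mult_left_mono)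
          then show ?thesis using True \<open>\<bar>x\<bar> \<le> z\<close> by (simp add: trunc_def abs_mult mult.commute)
        next
          case False
          have "x\<^sup>2 * exp (\<bar>c\<bar> * \<bar>x\<bar>) \<le> x\<^sup>2 * exp (\<bar>c\<bar> * z)"
            using \<open>\<bar>x\<bar> \<le> z\<close> by (intro mult_left_mono) (auto intro!: mult_left_mono)
          then show ?thesis
            using False \<open>\<bar>x\<bar> \<le> z\<close> by (simp add: trunc_def abs_mult mult.commute add_increasing)
        qed
      next
        case False
        then show ?thesis by (simp add: trunc_def)
      qed
      from mult_left_mono[OF this, of "c\<^sup>2 / 2"] show ?thesis
        by (simp add: power_mult_distrib mult.assoc)
    qed
    ultimately show ?thesis
      using exp_le_quadratic[of "c * trunc z x"] by linarith
  qed
  have intg: "integrable D (\<lambda>x. \<bar>c\<bar> / z * ?I z x + c\<^sup>2 / 2 * (exp (\<bar>c\<bar> * b) * x\<^sup>2 + exp (\<bar>c\<bar> *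
      z) * ?I b x))"
    by (intro Bochner_Integration.integrable_add integrable_mult_right integrable_tail_moment
      square_integrable)
  have "(\<integral>x. exp (c * trunc z x) \<partial>D) \<le> (\<integral>x. ?g x \<partial>D)"
    by (intro integral_mono int le Bochner_Integration.integrable_add integrable_mult_right
        integrable_id_D integrable_tail_moment square_integrable D.integrable_const)
  also have "\<dots> = 1 + (\<bar>c\<bar> / z * tail_moment z + c\<^sup>2 / 2 * (exp (\<bar>c\<bar> * b) * \<sigma>\<^sup>2 + exp (\<bar>c\<bar> * z) *
      tail_moment b))"
    using intg
        by (simp add: D.prob_space[unfolded D_space] mean_zero variance tail_moment_def
          integrable_tail_moment
        square_integrable integrable_id_D)
  finally show "(\<integral>x. exp (c * trunc z x) \<partial>D) \<le>
      1 + (\<bar>c\<bar> / z * tail_moment z + c\<^sup>2 / 2 * (exp (\<bar>c\<bar> * b) * \<sigma>\<^sup>2 + exp (\<bar>c\<bar> * z) *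
          tail_moment b))" .
qed

text \<open>
  The sign of \<open>c\<close> selects the upper or the lower tail.
\<close>
lemma chernoff_truncated_sum:
  assumes J: "finite J" and z: "z > 0" and s: "s > 0" and c: "\<bar>c\<bar> = s"
  shows "prob {\<omega> \<in> space M. c * (\<Sum>i\<in>J. trunc z (Z i \<omega>)) \<ge> s * u} \<le>
    exp (- (s * u) + real (card J) * (s / z * tail_moment z +
      s\<^sup>2 / 2 * (exp (s * b) * \<sigma>\<^sup>2 + exp (s * z) * tail_moment b)))"
proof -
  let ?r = "s / z * tail_moment z + s\<^sup>2 / 2 * (exp (s * b) * \<sigma>\<^sup>2 + exp (s * z) * tail_moment b)"
  let ?E = "\<lambda>i \<omega>. exp (c * trunc z (Z i \<omega>))"
  have c2: "c\<^sup>2 = s\<^sup>2" using c by (metis power2_abs)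
  have int: "integrable M (?E i)" for i
    by (rule integrable_D_Z_iff[of "\<lambda>x. exp (c * trunc z x)",
          THEN iffD2, OF _ trunc_mgf_bound(1)[OF z]]) measurable
  have ind: "indep_vars (\<lambda>_. borel) ?E J"
    by (rule indep_vars_compose2[OF indep_Z]) measurable
  have intP: "integrable M (\<lambda>\<omega>. \<Prod>i\<in>J. ?E i \<omega>)"
    by (rule indep_vars_integrable[OF J ind int])
  have "expectation (\<lambda>\<omega>. \<Prod>i\<in>J. ?E i \<omega>) = (\<Prod>i\<in>J. expectation (?E i))"
    by (rule indep_vars_lebesgue_integral[OF J ind int])
  also have "\<dots> = (\<integral>x. exp (c * trunc z x) \<partial>D) ^ card J"
    using expectation_Z[of "\<lambda>x. exp (c * trunc z x)"] by simp
  also have "\<dots> \<le> exp ?r ^ card J"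
  proof (rule power_mono)
    show "0 \<le> (\<integral>x. exp (c * trunc z x) \<partial>D)" by (rule integral_nonneg_AE) auto
    have "(\<integral>x. exp (c * trunc z x) \<partial>D) \<le> 1 + ?r"
      using trunc_mgf_bound(2)[OF z, of c b] by (simp add: c c2)
    also have "\<dots> \<le> exp ?r" by (rule exp_ge_add_one_self)
    finally show "(\<integral>x. exp (c * trunc z x) \<partial>D) \<le> exp ?r" .
  qed
  also have "\<dots> = exp (real (card J) * ?r)" by (simp add: exp_of_nat_mult)
  finally have E: "expectation (\<lambda>\<omega>. \<Prod>i\<in>J. ?E i \<omega>) \<le> exp (real (card J) * ?r)" .
  have "prob {\<omega> \<in> space M. c * (\<Sum>i\<in>J. trunc z (Z i \<omega>)) \<ge> s * u} =
      prob {\<omega> \<in> space M. (\<Prod>i\<in>J. ?E i \<omega>) \<ge> exp (s * u)}"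
    using J by (simp add: exp_sum[symmetric] sum_distrib_left)
  also have "\<dots> \<le> expectation (\<lambda>\<omega>. \<Prod>i\<in>J. ?E i \<omega>) / exp (s * u)"
    by (rule integral_Markov_inequality_measure[OF intP, where A="{}"]) (auto intro!: prod_nonneg)
  also have "\<dots> \<le> exp (real (card J) * ?r) / exp (s * u)"
    by (intro divide_right_mono E) auto
  also have "\<dots> = exp (- (s * u) + real (card J) * ?r)"
    by (simp only: exp_diff[symmetric]) (simp only: diff_conv_add_uminus add.commute)
  finally show ?thesis .
qed

lemma prob_sum_gt_le:
  assumes J: "finite J" and z: "z > 0" and s: "s > 0"
  shows "prob {\<omega> \<in> space M. \<bar>\<Sum>i\<in>J. Z i \<omega>\<bar> > u} \<le>
    real (card J) * D.prob {x. \<bar>x\<bar> > z} +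
    2 * exp (- (s * u) + real (card J) * (s / z * tail_moment z +
      s\<^sup>2 / 2 * (exp (s * b) * \<sigma>\<^sup>2 + exp (s * z) * tail_moment b)))"
proof -
  let ?e = "exp (- (s * u) + real (card J) * (s / z * tail_moment z +
      s\<^sup>2 / 2 * (exp (s * b) * \<sigma>\<^sup>2 + exp (s * z) * tail_moment b)))"
  define T where "T \<omega> = (\<Sum>i\<in>J. trunc z (Z i \<omega>))" for \<omega>
  have [measurable]: "T \<in> borel_measurable M" unfolding T_def by measurable
  let ?A = "\<Union>i\<in>J. {\<omega> \<in> space M. \<bar>Z i \<omega>\<bar> > z}"
  let ?B = "\<lambda>c. {\<omega> \<in> space M. c * T \<omega> \<ge> s * u}"
  have "prob {\<omega> \<in> space M. \<bar>\<Sum>i\<in>J. Z i \<omega>\<bar> > u} \<le> prob (?A \<union> (?B s \<union> ?B (-s)))"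
  proof (rule finite_measure_mono)
    show "?A \<union> (?B s \<union> ?B (-s)) \<in> events" using J by measurable
    show "{\<omega> \<in> space M. \<bar>\<Sum>i\<in>J. Z i \<omega>\<bar> > u} \<subseteq> ?A \<union> (?B s \<union> ?B (-s))"
    proof (rule subsetI)
      fix \<omega> assume \<omega>: "\<omega> \<in> {\<omega> \<in> space M. \<bar>\<Sum>i\<in>J. Z i \<omega>\<bar> > u}"
      show "\<omega> \<in> ?A \<union> (?B s \<union> ?B (-s))"
      proof (cases "\<exists>i\<in>J. \<bar>Z i \<omega>\<bar> > z")
        case False
        then have "T \<omega> = (\<Sum>i\<in>J. Z i \<omega>)" by (auto simp: T_def trunc_def intro!: sum.cong)
        with \<omega> have "u \<le> T \<omega> \<or> u \<le> - T \<omega>" by auto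
        then have "s * u \<le> s * T \<omega> \<or> s * u \<le> s * (- T \<omega>)"
          using s by (simp only: mult_le_cancel_left_pos)
        then show ?thesis using \<omega> by auto
      qed (use \<omega> in auto)
    qed
  qed
  also have "\<dots> \<le> prob ?A + prob (?B s \<union> ?B (-s))"
    using J by (intro measure_Un_le) measurable
  also have "prob (?B s \<union> ?B (-s)) \<le> prob (?B s) + prob (?B (-s))"
    by (intro measure_Un_le) measurable
  also have "prob ?A \<le> (\<Sum>i\<in>J. prob {\<omega> \<in> space M. \<bar>Z i \<omega>\<bar> > z})"
    by (intro finite_measure_subadditive_finite J) auto
  also have "\<dots> = real (card J) * D.prob {x. \<bar>x\<bar> > z}"
    using prob_Z[of "\<lambda>x. \<bar>x\<bar> > z"] by simp
  also have "prob (?B s) \<le> ?e"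
    unfolding T_def using s by (intro chernoff_truncated_sum J z s) auto
  also have "prob (?B (-s)) \<le> ?e"
    unfolding T_def using s by (intro chernoff_truncated_sum J z s) auto
  finally show ?thesis by simp
qed

text \<open>
  Beyond \<open>b\<close> the logarithmic factor of the moment is at least \<open>(ln b)^q\<close>.
\<close>
lemma tail_moment_le_log:
  assumes int: "integrable D (\<lambda>x. x\<^sup>2 * log_plus \<bar>x\<bar> powr q)"
    and q: "q \<ge> 0" and b: "b > 0" "ln b \<ge> 1"
  shows "tail_moment b \<le> (\<integral>x. x\<^sup>2 * log_plus \<bar>x\<bar> powr q \<partial>D) * ln b powr (- q)"
proof -
  have "tail_moment b \<le> (\<integral>x. x\<^sup>2 * log_plus \<bar>x\<bar> powr q * ln b powr (- q) \<partial>D)"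
    unfolding tail_moment_def
  proof (intro integral_mono integrable_tail_moment integrable_mult_left int)
    fix x :: real
    show "x\<^sup>2 * indicator {x. \<bar>x\<bar> > b} x \<le> x\<^sup>2 * log_plus \<bar>x\<bar> powr q * ln b powr (- q)"
    proof (cases "\<bar>x\<bar> > b")
      case True
      have "b > 1" using b ln_gt_zero_iff[of b] by linarith
      have "ln b \<le> log_plus \<bar>x\<bar>" using b True by (simp add: log_plus_def max.coboundedI1)
      then have "ln b powr q \<le> log_plus \<bar>x\<bar> powr q" using \<open>b > 1\<close> q by (intro powr_mono2) auto
      then have "1 \<le> log_plus \<bar>x\<bar> powr q * ln b powr (- q)"
      proof -
        have "0 < ln b powr q" using \<open>b > 1\<close> by simp
        with \<open>ln b powr q \<le> _\<close> show ?thesis by (simp add: powr_minus divide_inverse[symmetric])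
      qed
      from mult_left_mono[OF this, of "x\<^sup>2"] True show ?thesis by (simp add: mult.assoc)
    qed simp
  qed
  then show ?thesis by simp
qed

text \<open>
  The number of \<open>n\<close> with \<open>c * n \<le> G x\<close> is at most \<open>1 + G x / c\<close>; integrate.
\<close>
lemma summable_prob_ge_linear:
  assumes [measurable]: "G \<in> borel_measurable borel" and int: "integrable D G"
    and pos: "\<And>x. G x \<ge> 0" and c: "c > 0"
  shows "summable (\<lambda>n. D.prob {x. G x \<ge> c * real n})"
proof (rule bounded_imp_summable)
  fix N
  have "(\<Sum>n\<le>N. D.prob {x. G x \<ge> c * real n}) = (\<integral>x. (\<Sum>n\<le>N. indicator {x. G x \<ge> c * real n} x) \<partial>D)"
    by (subst Bochner_Integration.integral_sum) (auto simp: D.emeasure_eq_measure)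
  also have "\<dots> \<le> (\<integral>x. 1 + G x / c \<partial>D)"
  proof (intro integral_mono)
    show "integrable D (\<lambda>x. \<Sum>n\<le>N. indicator {x. G x \<ge> c * real n} x :: real)"
      by (intro Bochner_Integration.integrable_sum) (auto simp: D.emeasure_eq_measure)
    show "integrable D (\<lambda>x. 1 + G x / c)" using int by auto
    fix x
    have "(\<Sum>n\<le>N. indicator {x. G x \<ge> c * real n} x :: real) = real (card {n\<in>{..N}. c * real n \<le>
        G x})"
      by (simp add: indicator_def sum.If_cases Int_def conj_commute)
    also have "card {n\<in>{..N}. c * real n \<le> G x} \<le> card {..nat \<lfloor>G x / c\<rfloor>}"
      using c by (intro card_mono) (auto simp: le_nat_floor field_simps)
    then have "real (card {n\<in>{..N}. c * real n \<le> G x}) \<le> 1 + real (nat \<lfloor>G x / c\<rfloor>)" by simp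
    also have "real (nat \<lfloor>G x / c\<rfloor>) \<le> G x / c" using pos[of x] c by (simp add: of_nat_nat)
    finally show "(\<Sum>n\<le>N. indicator {x. G x \<ge> c * real n} x :: real) \<le> 1 + G x / c" by simp
  qed
  finally show "(\<Sum>n\<le>N. D.prob {x. G x \<ge> c * real n}) \<le> (\<integral>x. 1 + G x / c \<partial>D)" .
qed simp

end

context iid_sequence
begin

text \<open>
  The two-sided tail estimate behind the upper bound, uniform over index sets of size at most
  \<open>C * a\<close> with \<open>a = window_length p n\<close>. Write \<open>d = norming p n\<close> and \<open>L = ln (ln n)\<close>. With some \<open>\<kappa>\<close>
  strictly between the variance factor \<open>C * \<sigma>^2\<close> and \<open>t^2\<close>, the exponential parameter
  \<open>s = 2 (p + 1) t L / (\<kappa> d)\<close> makes the linear term \<open>s t d = 2 (p + 1) (t^2 / \<kappa>) L\<close>, while the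
  quadratic term is at most half of that. What remains is \<open>(ln n)^(- (p + 1) t^2 / \<kappa>)\<close>, and
  \<open>t^2 / \<kappa> > 1\<close> makes it summable against \<open>1 / a\<close>.
\<close>
lemma summable_tail_bound:
  assumes p: "p > 0" and mom: "integrable D (moment_weight p)"
    and C: "C > 0" and t: "t > 0" and Ct: "C * \<sigma>\<^sup>2 < t\<^sup>2"
  shows "\<exists>h. summable h \<and> (\<forall>n. 0 \<le> h n) \<and> (\<forall>\<^sub>F n in sequentially. \<forall>J. finite J \<longrightarrow>
    real (card J) \<le> C * window_length p n \<longrightarrow>
    prob {\<omega> \<in> space M. \<bar>\<Sum>i\<in>J. Z i \<omega>\<bar> > t * norming p n} \<le> window_length p n * h n)"
proof -
  define \<kappa> where "\<kappa> = (C * \<sigma>\<^sup>2 + t\<^sup>2) / 2"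
  have "0 \<le> C * \<sigma>\<^sup>2" using C by simp
  then have \<kappa>: "\<kappa> > 0" "C * \<sigma>\<^sup>2 < \<kappa>" "\<kappa> < t\<^sup>2" using Ct by (auto simp: \<kappa>_def)
  obtain \<delta> where \<delta>: "\<delta> > 0" "exp \<delta> * (C * \<sigma>\<^sup>2) \<le> \<kappa>"
  proof (cases "\<sigma> = 0")
    case True
    then show ?thesis using \<kappa> by (intro that[of 1]) auto
  next
    case False
    then have "C * \<sigma>\<^sup>2 > 0" using C by simp
    then show ?thesis using \<kappa> by (intro that[of "ln (\<kappa> / (C * \<sigma>\<^sup>2))"]) auto
  qed
  define q where "q = 3 * p / 4"
  \<comment> \<open>The truncation level \<open>\<eta> * d\<close> is such that \<open>exp (s * \<eta> * d)\<close> is exactly \<open>(ln n)^(p / 2)\<close>.\<close>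
  define \<eta> where "\<eta> = \<kappa> * p / (4 * (p + 1) * t)"
  define c0 where "c0 = 2 * (p + 1) * t / \<kappa>"
  define e where "e = (p + 1) * (t\<^sup>2 / \<kappa> - 1)"
  have pos: "\<eta> > 0" "c0 > 0" "e > 0" "q > 0"
    using p t \<kappa> by (auto simp: \<eta>_def c0_def e_def q_def)
  obtain K where K: "\<And>y. y\<^sup>2 * log_plus \<bar>y\<bar> powr q \<le> K * moment_weight p y"
    using moment_weight_ge_power[OF p] unfolding q_def by blast
  have intq: "integrable D (\<lambda>x. x\<^sup>2 * log_plus \<bar>x\<bar> powr q)"
  proof (rule Bochner_Integration.integrable_bound)
    show "integrable D (\<lambda>x. K * moment_weight p x)" using mom by (rule integrable_mult_right)
    show "AE x in D. norm (x\<^sup>2 * log_plus \<bar>x\<bar> powr q) \<le> norm (K * moment_weight p x)"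
    proof (intro AE_I2)
      fix x
      have "norm (x\<^sup>2 * log_plus \<bar>x\<bar> powr q) \<le> K * moment_weight p x" using K by simp
      then show "norm (x\<^sup>2 * log_plus \<bar>x\<bar> powr q) \<le> norm (K * moment_weight p x)"
        unfolding real_norm_def by linarith
    qed
  qed measurable
  define K0 where "K0 = (\<integral>x. x\<^sup>2 * log_plus \<bar>x\<bar> powr q \<partial>D)"
  have K0: "K0 \<ge> 0" unfolding K0_def by (rule integral_nonneg_AE) auto
  obtain c where c: "c > 0"
    and lin: "eventually (\<lambda>n. \<forall>y. \<bar>y\<bar> > \<eta> * norming p n \<longrightarrow> c * real n \<le> moment_weight p y) at_top"
    using moment_weight_ge_linear[OF p pos(1)] by blast
  define h where "h n =
      C * D.prob {x. \<bar>x\<bar> > \<eta> * norming p n} + 2 * exp 1 * (1 / (real n * ln (real n) powr (1 +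
          e)))" for n
  have "summable (\<lambda>n. D.prob {x. \<bar>x\<bar> > \<eta> * norming p n})"
  proof (rule summable_comparison_test_ev)
    show "summable (\<lambda>n. D.prob {x. moment_weight p x \<ge> c * real n})"
      by (rule summable_prob_ge_linear) (use mom c moment_weight_nonneg in auto)
    show "eventually (\<lambda>n. norm (D.prob {x. \<bar>x\<bar> > \<eta> * norming p n}) \<le>
        D.prob {x. moment_weight p x \<ge> c * real n}) at_top"
      using lin by eventually_elim (auto intro!: D.finite_measure_mono)
  qed
  then have "summable h"
    unfolding h_def using pos by (intro summable_add summable_mult summable_inverse_n_ln_powr)
  moreover have "0 \<le> h n" for n
    using C by (auto simp: h_def)
  moreover have "\<forall>\<^sub>F n in sequentially. \<forall>J. finite J \<longrightarrow> real (card J) \<le> C * window_length p n \<longrightarrow>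
    prob {\<omega> \<in> space M. \<bar>\<Sum>i\<in>J. Z i \<omega>\<bar> > t * norming p n} \<le> window_length p n * h n"
  proof -
    let ?L = "\<lambda>n::nat. ln (ln (real n))"
    define c1 where "c1 = C * t / (\<kappa> * \<eta>) * K0"
    define c2 where "c2 = C * (p + 1) * t\<^sup>2 / \<kappa>\<^sup>2 * K0"
    define r where "r n = c1 * (ln (real n) / 4) powr (-q) +
      c2 * (?L n * ln (real n) powr (p / 2) * (ln (real n) / 4) powr (-q))" for n
    have "(\<lambda>n. (ln (real n) / 4) powr (-q)) \<longlonglongrightarrow> 0" using pos(4) by real_asymp
    moreover have "(\<lambda>n. ?L n * ln (real n) powr (p / 2) * (ln (real n) / 4) powr (-q)) \<longlonglongrightarrow> 0"
      using chernoff_remainder_tendsto_0[OF p] by (simp add: q_def)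
    ultimately have "r \<longlonglongrightarrow> c1 * 0 + c2 * 0"
      unfolding r_def by (intro tendsto_intros)
    then have "eventually (\<lambda>n. r n < 1) at_top" by (auto dest: order_tendstoD(2)[where a=1])
    moreover have "eventually (\<lambda>n::nat. ?L n > 0) at_top" by real_asymp
    moreover have "eventually (\<lambda>n::nat. ln (real n) / 4 \<ge> 1) at_top" by real_asymp
    moreover have "eventually (\<lambda>n. window_length p n > 0) at_top"
        "eventually (\<lambda>n. norming p n > 0) at_top"
      using window_length_at_top[OF p] norming_at_top[OF p]
          by (simp_all add: filterlim_at_top_dense)
    moreover have "\<delta> / c0 > 0" using \<delta> pos by simp
    note ln_norming_div_ge[OF p this]
    ultimately show ?thesis
      using norming_squared[OF p] ln_norming_ge[OF p pos(1)]
    proof eventually_elim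
      case (elim n)
      define L where "L = ?L n"
      define a where "a = window_length p n"
      define d where "d = norming p n"
      define s where "s = c0 * L / d"
      define z where "z = \<eta> * d"
      define b where "b = \<delta> / c0 * d / L"
      have P: "L > 0" "a > 0" "d > 0" "d\<^sup>2 = 2 * (p + 1) * a * L" "ln z \<ge> ln (real n) / 4"
        "ln b \<ge> ln (real n) / 4" "ln (real n) / 4 \<ge> 1"
        using elim by (simp_all add: L_def a_def d_def z_def b_def)
      have szb: "s > 0" "z > 0" "b > 0" using P pos \<delta> by (auto simp: s_def z_def b_def)
      have lnn: "ln (real n) > 0" using P by linarith
      have n: "real n > 0" using lnn by (cases "n = 0") auto
      have sz: "s * z = p / 2 * L"
      proof -
        have "2 * x * t / \<kappa> * (\<kappa> * p / (4 * x * t)) = p / 2" if "x > 0" for x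
          using that \<kappa> t by (simp add: field_simps)
        from this[of "p + 1"] have "c0 * \<eta> = p / 2" using p by (simp add: c0_def \<eta>_def)
        then show ?thesis using P by (simp add: s_def z_def)
      qed
      have sb: "s * b = \<delta>" using P pos by (simp add: s_def b_def)
      have su: "s * (t * d) = 2 * ((p + 1) * (t\<^sup>2 / \<kappa>) * L)"
        using P by (simp add: s_def c0_def power2_eq_square)
      have s_z: "a * (s / z) = t / (\<kappa> * \<eta>)"
      proof -
        have gen: "a * ((2 * x * t / \<kappa>) * L / (\<eta> * (2 * x * a * L))) = t / (\<kappa> * \<eta>)" if "x > 0" for x
          using that P(1,2) pos \<kappa> by (simp add: field_simps)
        have "s / z = c0 * L / (\<eta> * d\<^sup>2)"
          unfolding s_def z_def power2_eq_square by (simp add: mult_ac)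
        then show ?thesis using gen[of "p + 1"] p unfolding P(4) c0_def by simp
      qed
      define G where "G = (p + 1) * t\<^sup>2 / \<kappa>\<^sup>2 * L"
      have G: "G \<ge> 0" "G * \<kappa> = (p + 1) * (t\<^sup>2 / \<kappa>) * L"
        using P p \<kappa> by (simp_all add: G_def power2_eq_square)
      have s2: "a * (s\<^sup>2 / 2) = G"
      proof -
        have gen: "a * ((2 * x * t / \<kappa> * L)\<^sup>2 / (2 * x * a * L) / 2) =
            x * t\<^sup>2 / \<kappa>\<^sup>2 * L" if "x > 0" for x
          using that P(1,2) \<kappa> by (simp add: field_simps power2_eq_square)
        have "s\<^sup>2 = (c0 * L)\<^sup>2 / d\<^sup>2"
          unfolding s_def by (simp add: power_divide)
        then show ?thesis using gen[of "p + 1"] p unfolding P(4) c0_def G_def by simp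
      qed
      have V: "tail_moment y \<le> K0 * (ln (real n) / 4) powr (-q)"
          if "y > 0" "ln y \<ge> ln (real n) / 4" for y
      proof -
        have "tail_moment y \<le> K0 * ln y powr (-q)"
          unfolding K0_def using that P pos by (intro tail_moment_le_log intq) auto
        also have "\<dots> \<le> K0 * (ln (real n) / 4) powr (-q)"
          using that P pos K0 by (intro mult_left_mono powr_mono2') auto
        finally show ?thesis .
      qed
      have esz: "exp (s * z) = ln (real n) powr (p / 2)"
        using lnn by (simp add: sz powr_def L_def)
      show ?case
      proof (intro allI impI)
        fix J :: "nat set" assume J: "finite J" "real (card J) \<le> C * window_length p n"
        let ?Q = "s / z * tail_moment z + s\<^sup>2 / 2 * (exp (s * b) * \<sigma>\<^sup>2 + exp (s * z) *
            tail_moment b)"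
        have Q0: "0 \<le> ?Q" using szb
            by (intro add_nonneg_nonneg mult_nonneg_nonneg tail_moment_nonneg) auto
        have "real (card J) * ?Q \<le> C * a * ?Q"
          using J Q0 by (intro mult_right_mono) (simp_all add: a_def)
        also have "\<dots> =
            C * (a * (s / z)) * tail_moment z + C * (a * (s\<^sup>2 / 2)) * (exp \<delta> * \<sigma>\<^sup>2 + exp (s * z) *
                tail_moment b)"
          unfolding sb by (simp add: algebra_simps)
        also have "\<dots> = C * (t / (\<kappa> * \<eta>)) * tail_moment z +
            G * (exp \<delta> * (C * \<sigma>\<^sup>2)) +
            C * G * ln (real n) powr (p / 2) * tail_moment b"
          unfolding s_z s2 esz by (simp add: algebra_simps)
        also have "\<dots> \<le> C * (t / (\<kappa> * \<eta>)) * (K0 * (ln (real n) / 4) powr (-q)) +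
            G * \<kappa> +
            C * G * ln (real n) powr (p / 2) * (K0 * (ln (real n) / 4) powr (-q))"
          using C t \<kappa> pos p P szb G(1)
          by (intro add_mono mult_left_mono V \<delta>(2) mult_nonneg_nonneg divide_nonneg_nonneg) auto
        also have "\<dots> = r n + (p + 1) * (t\<^sup>2 / \<kappa>) * L"
          unfolding G(2) by (simp add: r_def c1_def c2_def L_def G_def mult_ac)
        also have "\<dots> \<le> 1 + (p + 1) * (t\<^sup>2 / \<kappa>) * L" using elim(1) by simp
        finally have Q_le: "real (card J) * ?Q \<le> 1 + (p + 1) * (t\<^sup>2 / \<kappa>) * L" .
        have "- x + y \<le> 1 - u" if "y \<le> 1 + u" "x = 2 * u" for x y u :: real
          using that by linarith
        from this[OF Q_le su]
        have "- (s * (t * d)) + real (card J) * ?Q \<le> 1 - (p + 1) * (t\<^sup>2 / \<kappa>) * L" .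
        then have "exp (- (s * (t * d)) + real (card J) * ?Q) \<le> exp (1 - (p + 1) * (t\<^sup>2 / \<kappa>) * L)"
          by (simp only: exp_le_cancel_iff)
        also have "\<dots> = exp 1 * ln (real n) powr (- ((p + 1) * (t\<^sup>2 / \<kappa>)))"
          using lnn by (simp add: powr_def L_def exp_add[symmetric])
        also have "- ((p + 1) * (t\<^sup>2 / \<kappa>)) = - p - (1 + e)" by (simp add: e_def algebra_simps)
        also have "ln (real n) powr (- p - (1 + e)) = a * (1 / (real n * ln (real n) powr (1 + e)))"
          using n by (simp add: a_def window_length_def powr_diff powr_minus field_simps)
        finally have exb: "exp (- (s * (t * d)) + real (card J) * ?Q) \<le>
            exp 1 * (a * (1 / (real n * ln (real n) powr (1 + e))))" .
        have "prob {\<omega> \<in> space M. \<bar>\<Sum>i\<in>J. Z i \<omega>\<bar> > t * d} \<le>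
            real (card J) * D.prob {x. \<bar>x\<bar> > z} + 2 * exp (- (s * (t * d)) + real (card J) * ?Q)"
          by (rule prob_sum_gt_le) (use J szb in auto)
        also have "\<dots> \<le>
            C * a * D.prob {x. \<bar>x\<bar> > z} + 2 * (exp 1 * (a * (1 / (real n * ln (real n) powr (1 +
                e)))))"
          using J by (intro add_mono mult_right_mono mult_left_mono exb) (auto simp: a_def)
        also have "\<dots> = a * h n" by (simp add: h_def z_def d_def algebra_simps)
        finally show "prob {\<omega> \<in> space M. \<bar>\<Sum>i\<in>J. Z i \<omega>\<bar> > t * norming p n} \<le> window_length p n * h n"
          by (simp add: a_def d_def)
      qed
    qed
  qed
  ultimately show ?thesis by blast
qed

end

section \<open>The upper bound\<close>

text \<open>
  The weighted number of occurrences has finite expectation. This is the first Borel-Cantelli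
  lemma when all weights are 1; here the weights will tend to 0.
\<close>
lemma (in prob_space) AE_summable_weighted_indicator:
  fixes E :: "nat \<Rightarrow> 'a set" and w h :: "nat \<Rightarrow> real"
  assumes E [measurable]: "\<And>n. E n \<in> events" and w: "\<And>n. w n \<ge> 0"
    and h: "summable h" and le: "eventually (\<lambda>n. w n * prob (E n) \<le> h n) sequentially"
  shows "AE \<omega> in M. summable (\<lambda>n. w n * indicator (E n) \<omega>)"
proof -
  have "summable (\<lambda>n. w n * prob (E n))"
    by (rule summable_comparison_test_ev[OF _ h]) (use le w in \<open>auto elim: eventually_mono\<close>)
  then have "(\<Sum>n. ennreal (w n * prob (E n))) \<noteq> \<top>"
    using w by (intro ennreal_suminf_neq_top) auto
  moreover have "(\<integral>\<^sup>+\<omega>. (\<Sum>n. ennreal (w n * indicator (E n) \<omega>)) \<partial>M) =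
      (\<Sum>n. ennreal (w n * prob (E n)))"
  proof (subst nn_integral_suminf)
    have "(\<integral>\<^sup>+\<omega>. ennreal (w n * indicator (E n) \<omega>) \<partial>M) = ennreal (w n * prob (E n))" for n
      using w[of n]
          by (simp add: ennreal_mult' ennreal_indicator nn_integral_cmult emeasure_eq_measure
            ennreal_mult)
    then show "(\<Sum>n. \<integral>\<^sup>+\<omega>. ennreal (w n * indicator (E n) \<omega>) \<partial>M) =
        (\<Sum>n. ennreal (w n * prob (E n)))" by simp
  qed measurable
  ultimately have "AE \<omega> in M. (\<Sum>n. ennreal (w n * indicator (E n) \<omega>)) \<noteq> \<infinity>"
    by (intro nn_integral_PInf_AE) auto
  then show ?thesis
    by eventually_elim (use w in \<open>auto intro!: summable_suminf_not_top\<close>)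
qed

context iid_sequence
begin

text \<open>
  A window that starts at \<open>k\<close> slightly after \<open>n\<close> differs from the window at \<open>n\<close> by a short piece
  at each end, of at most \<open>3 * \<epsilon> * window_length p n\<close> terms. The event \<open>E n\<close> below says that the
  window at \<open>n\<close> or one of the end pieces is too large, and outside it no window that starts
  shortly after \<open>n\<close> can be too large. Weighting \<open>E n\<close> with the reciprocal window length then
  excludes violations for large \<open>k\<close>.
\<close>
lemma window_upper_bound:
  assumes p: "p > 0" and mom: "integrable D (moment_weight p)"
    and \<sigma>: "\<sigma> \<ge> 0" and \<tau>: "\<tau> > \<sigma>"
  shows "AE \<omega> in M. \<forall>\<^sub>F k in sequentially.
    \<bar>\<Sum>i\<in>{k..<k + window_size p k}. Z i \<omega>\<bar> \<le> \<tau> * norming p k"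
proof -
  \<comment> \<open>The excess \<open>\<tau> - \<sigma>\<close> is shared by the main window and two end pieces, each end piece costing
    \<open>2 * t2\<close> because of the factor 2 in Ottaviani's inequality.\<close>
  define t1 where "t1 = (\<sigma> + \<tau>) / 2"
  define t2 where "t2 = (\<tau> - \<sigma>) / 8"
  have t: "t1 > \<sigma>" "t1 > 0" "t2 > 0" "t1 + 4 * t2 = \<tau>" "\<tau> > 0"
    using \<sigma> \<tau> by (auto simp: t1_def t2_def field_simps)
  \<comment> \<open>The end pieces have variance at most \<open>3 * \<epsilon> * \<sigma>^2\<close> relative to the window length, which has
    to be below \<open>t2^2\<close>.\<close>
  define \<epsilon> where "\<epsilon> = min 1 (t2\<^sup>2 / (6 * (\<sigma>\<^sup>2 + 1)))"
  have \<epsilon>: "\<epsilon> > 0" "\<epsilon> \<le> 1" using t by (auto simp: \<epsilon>_def add_nonneg_pos)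
  have "3 * \<epsilon> * \<sigma>\<^sup>2 \<le> 3 * \<epsilon> * (\<sigma>\<^sup>2 + 1)" using \<epsilon> by (intro mult_left_mono) auto
  also have "\<dots> \<le> 3 * (t2\<^sup>2 / (6 * (\<sigma>\<^sup>2 + 1))) * (\<sigma>\<^sup>2 + 1)"
    by (intro mult_right_mono mult_left_mono) (auto simp: \<epsilon>_def)
  also have "\<dots> = t2\<^sup>2 / 2" using add_nonneg_pos[of "\<sigma>\<^sup>2" 1] by (simp add: field_simps)
  finally have \<epsilon>\<sigma>: "3 * \<epsilon> * \<sigma>\<^sup>2 \<le> t2\<^sup>2 / 2" .
  define S where "S n j \<omega> = (\<Sum>i\<in>{n..<n+j}. Z i \<omega>)" for n j \<omega>
  have [measurable]: "S n j \<in> borel_measurable M" for n j unfolding S_def by measurable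
  let ?a = "window_length p" and ?d = "norming p" and ?m = "window_size p"
  define l where "l n = nat \<lfloor>3 * \<epsilon> * ?a n\<rfloor>" for n
  have l: "real (l n) \<le> 3 * \<epsilon> * ?a n" for n
    using \<epsilon> window_length_nonneg[of p n] by (simp add: l_def of_nat_nat)
  obtain h1 where h1: "summable h1" "\<And>n. 0 \<le> h1 n"
    "\<forall>\<^sub>F n in sequentially. \<forall>J. finite J \<longrightarrow> real (card J) \<le> 1 * ?a n \<longrightarrow>
      prob {\<omega> \<in> space M. \<bar>\<Sum>i\<in>J. Z i \<omega>\<bar> > t1 * ?d n} \<le> ?a n * h1 n"
    using summable_tail_bound[OF p mom, of 1 t1] t \<sigma> power_strict_mono[of \<sigma> t1 2] by auto
  obtain h2 where h2: "summable h2" "\<And>n. 0 \<le> h2 n"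
    "\<forall>\<^sub>F n in sequentially. \<forall>J. finite J \<longrightarrow> real (card J) \<le> 3 * \<epsilon> * ?a n \<longrightarrow>
      prob {\<omega> \<in> space M. \<bar>\<Sum>i\<in>J. Z i \<omega>\<bar> > t2 * ?d n} \<le> ?a n * h2 n"
    using summable_tail_bound[OF p mom, of "3 * \<epsilon>" t2] t \<epsilon> le_less_trans[OF \<epsilon>\<sigma>, of "t2\<^sup>2"] by auto
  define E1 where "E1 n = {\<omega> \<in> space M. \<bar>S n (?m n) \<omega>\<bar> > t1 * ?d n}" for n
  define E2 where "E2 q n = {\<omega> \<in> space M. \<exists>j\<le>l n. \<bar>S q j \<omega>\<bar> > 2 * (t2 * ?d n)}" for q n
  define E where "E n = E1 n \<union> (E2 n n \<union> E2 (n + ?m n) n)" for n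
  have [measurable]: "E1 n \<in> events" "E2 q n \<in> events" "E n \<in> events" for q n
    unfolding E_def E1_def E2_def by measurable
  have ev_a: "eventually (\<lambda>n. ?a n > c) at_top" and ev_d: "eventually (\<lambda>n. ?d n > c) at_top"
    and ev_da: "eventually (\<lambda>n. (?d n)\<^sup>2 / ?a n > c) at_top" for c
    using window_length_at_top[OF p] norming_at_top[OF p] norming_square_over_window_length[OF p]
    by (simp_all add: filterlim_at_top_dense)
  have "eventually (\<lambda>n. 1 / ?a n * prob (E n) \<le> h1 n + 4 * h2 n) at_top"
    using h1(3) h2(3) ev_a[of 0] ev_d[of 0] ev_da[of 2]
  proof eventually_elim
    case (elim n)
    have cond: "2 * (real (l n) * \<sigma>\<^sup>2) \<le> (t2 * ?d n)\<^sup>2"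
    proof -
      have "real (l n) * \<sigma>\<^sup>2 \<le> 3 * \<epsilon> * ?a n * \<sigma>\<^sup>2" by (intro mult_right_mono l) auto
      also have "\<dots> \<le> ?a n * (t2\<^sup>2 / 2)"
        using mult_left_mono[OF \<epsilon>\<sigma>, of "?a n"] elim by (simp add: algebra_simps)
      finally have "2 * (real (l n) * \<sigma>\<^sup>2) \<le> t2\<^sup>2 * ?a n" by (simp add: mult_ac)
      also have "\<dots> \<le> t2\<^sup>2 * (?d n)\<^sup>2"
        using elim by (intro mult_left_mono) (simp_all add: field_simps)
      finally show ?thesis by (simp add: power_mult_distrib)
    qed
    have P2: "prob (E2 q n) \<le> 2 * (?a n * h2 n)" for q
    proof -
      have "prob (E2 q n) \<le> 2 * prob {\<omega> \<in> space M. \<bar>S q (l n) \<omega>\<bar> > t2 * ?d n}"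
        unfolding E2_def S_def using elim t cond by (intro ottaviani) auto
      also have "prob {\<omega> \<in> space M. \<bar>S q (l n) \<omega>\<bar> > t2 * ?d n} \<le> ?a n * h2 n"
        unfolding S_def using elim l[of n] by auto
      finally show ?thesis by simp
    qed
    have P1: "prob (E1 n) \<le> ?a n * h1 n"
      unfolding E1_def S_def using elim window_size_bounds[of p n] by auto
    have "prob (E n) \<le> prob (E1 n) + prob (E2 n n \<union> E2 (n + ?m n) n)"
      unfolding E_def by (intro measure_Un_le) auto
    also have "prob (E2 n n \<union> E2 (n + ?m n) n) \<le> prob (E2 n n) + prob (E2 (n + ?m n) n)"
      by (intro measure_Un_le) auto
    finally have "prob (E n) \<le> ?a n * (h1 n + 4 * h2 n)"
      using P1 P2[of n] P2[of "n + ?m n"] by (simp add: algebra_simps)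
    then show ?case using elim by (simp add: field_simps)
  qed
  then have AE_sum: "AE \<omega> in M. summable (\<lambda>n. 1 / ?a n * indicator (E n) \<omega> :: real)"
    by (intro AE_summable_weighted_indicator[where h="\<lambda>n. h1 n + 4 * h2 n"]
        summable_add summable_mult h1 h2)
      (auto simp: window_length_nonneg)
  obtain N1 where N1: "\<And>n k. n \<ge> N1 \<Longrightarrow> k \<ge> n \<Longrightarrow> ?a n \<le> ?a k \<and> ?a k - ?a n \<le> real k - real n"
    using window_length_mono_lipschitz[OF p] by blast
  obtain N2 where N2: "\<And>n k. n \<ge> N2 \<Longrightarrow> k \<ge> n \<Longrightarrow> ?d n \<le> ?d k"
    using norming_mono[OF p] by blast
  obtain N3 where N3: "\<And>n. n \<ge> N3 \<Longrightarrow> ?a n > 1 / \<epsilon> \<and> ?d n > 0 \<and> ?a n \<le> real n"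
    using eventually_conj[OF ev_a[of "1 / \<epsilon>"] eventually_conj[OF ev_d[of 0] window_length_le[OF p]]]
    by (auto simp: eventually_at_top_linorder)
  from AE_sum AE_space show ?thesis
  proof eventually_elim
    fix \<omega>
    assume sum: "summable (\<lambda>n. 1 / ?a n * indicator (E n) \<omega> :: real)"
    let ?w = "\<lambda>n. 1 / ?a n * indicator (E n) \<omega> :: real"
    assume \<omega>: "\<omega> \<in> space M"
    \<comment> \<open>The tail of the convergent weighted series is below \<open>\<epsilon> / 2\<close>, the weight that one violation
      forces.\<close>
    obtain N0 where N0: "\<And>m n. m \<ge> N0 \<Longrightarrow> norm (sum ?w {m..<n}) < \<epsilon> / 2"
      using sum \<epsilon> unfolding summable_Cauchy by (metis half_gt_zero)
    define N where "N = Max {N0, N1, N2, N3}"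
    have N: "N \<ge> N0" "N \<ge> N1" "N \<ge> N2" "N \<ge> N3" by (auto simp: N_def)
    have "\<bar>S k (?m k) \<omega>\<bar> \<le> \<tau> * ?d k" if k: "k \<ge> 2 * N" for k
    proof (rule ccontr)
      assume viol: "\<not> \<bar>S k (?m k) \<omega>\<bar> \<le> \<tau> * ?d k"
      have ka: "?a k > 1 / \<epsilon>" "?a k \<le> real k" "?a k > 0"
        using N3[of k] k N \<epsilon> window_length_nonneg[of p k]
            by (auto intro: order.strict_trans[of 0 "1/\<epsilon>"])
      have \<epsilon>a: "\<epsilon> * ?a k / 2 \<le> ?a k / 2" "\<epsilon> * ?a k > 0"
        using \<epsilon> ka by auto
      define n1 where "n1 = nat \<lceil>real k - \<epsilon> * ?a k / 2\<rceil>"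
      have n1: "real n1 \<ge> real k - \<epsilon> * ?a k / 2" "real n1 < real k - \<epsilon> * ?a k / 2 + 1"
      proof -
        have "0 \<le> real k - \<epsilon> * ?a k / 2" using \<epsilon>a ka by linarith
        then show "real n1 \<ge> real k - \<epsilon> * ?a k / 2" "real n1 < real k - \<epsilon> * ?a k / 2 + 1"
          unfolding n1_def by linarith+
      qed
      have n1N: "n1 \<ge> N" using n1 \<epsilon>a ka k by linarith
      have inE: "\<omega> \<in> E n" "?a n \<le> ?a k" "?a n > 0" if n: "n \<in> {n1..<Suc k}" for n
      proof -
        have nN: "n \<ge> N" "n \<le> k" "n1 \<le> n" using n n1N by auto
        have lip: "?a n \<le> ?a k" "?a k - ?a n \<le> real k - real n" using N1[of n k] nN N by auto
        have kn: "real k - real n \<le> \<epsilon> * ?a k / 2" using n1 nN by linarith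
        have "?a k / 2 \<le> ?a n" using lip kn \<epsilon>a by linarith
        then have "\<epsilon> * (?a k / 2) \<le> \<epsilon> * ?a n" using \<epsilon> by (intro mult_left_mono) auto
        then have kn': "real k - real n \<le> \<epsilon> * ?a n" using kn by simp
        have na: "?a n > 1 / \<epsilon>" "?d n > 0" using N3[of n] nN N by auto
        have \<epsilon>an: "\<epsilon> * ?a n > 1" using na \<epsilon> by (simp add: field_simps)
        then show "?a n > 0" using \<epsilon> zero_less_mult_pos[of \<epsilon> "?a n"] by linarith
        define j1 where "j1 = k - n"
        define j2 where "j2 = k + ?m k - (n + ?m n)"
        have mm: "?m n \<le> ?m k" using lip unfolding window_size_def by (intro nat_mono floor_mono)
        have j2: "n + ?m n + j2 = k + ?m k" using mm nN by (simp add: j2_def)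
        have jl: "j1 \<le> l n" "j2 \<le> l n"
        proof -
          have "real j1 \<le> 3 * \<epsilon> * ?a n" using kn' \<epsilon>an nN by (simp add: j1_def of_nat_diff)
          then show "j1 \<le> l n" unfolding l_def by (simp add: le_nat_floor)
          have "real j2 = real k - real n + real (?m k) - real (?m n)" using j2 by linarith
          also have "\<dots> \<le> 3 * \<epsilon> * ?a n"
            using window_size_bounds[of p k] window_size_bounds[of p n] lip kn' \<epsilon>an by linarith
          finally show "j2 \<le> l n" unfolding l_def by (simp add: le_nat_floor)
        qed
        show "\<omega> \<in> E n"
        proof (rule ccontr)
          assume "\<omega> \<notin> E n"
          then have b: "\<bar>S n (?m n) \<omega>\<bar> \<le> t1 * ?d n" "\<bar>S n j1 \<omega>\<bar> \<le> 2 * (t2 * ?d n)"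
            "\<bar>S (n + ?m n) j2 \<omega>\<bar> \<le> 2 * (t2 * ?d n)"
            using \<omega> jl unfolding E_def E1_def E2_def by (auto simp: not_less)
          have "S n j1 \<omega> + S k (?m k) \<omega> = (\<Sum>i\<in>{n..<k + ?m k}. Z i \<omega>)"
            unfolding S_def j1_def using nN by (simp add: sum.atLeastLessThan_concat)
          also have "\<dots> = S n (?m n) \<omega> + S (n + ?m n) j2 \<omega>"
            unfolding S_def using j2 by (simp add: sum.atLeastLessThan_concat)
          finally have "\<bar>S k (?m k) \<omega>\<bar> \<le> t1 * ?d n + 4 * t2 * ?d n" using b by linarith
          also have "\<dots> = \<tau> * ?d n" by (simp add: t(4)[symmetric] algebra_simps)
          also have "\<dots> \<le> \<tau> * ?d k" using t nN N by (intro mult_left_mono N2) auto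
          finally show False using viol by simp
        qed
        show "?a n \<le> ?a k" by fact
      qed
      have "\<epsilon> / 2 \<le> real (card {n1..<Suc k}) * (1 / ?a k)"
      proof -
        have "n1 \<le> k" using n1 \<epsilon>a by linarith
        then have "real (card {n1..<Suc k}) = real k + 1 - real n1" by (simp add: of_nat_diff)
        also have "\<dots> \<ge> \<epsilon> * ?a k / 2" using n1 by linarith
        finally show ?thesis using ka by (simp add: field_simps)
      qed
      also have "\<dots> = (\<Sum>n\<in>{n1..<Suc k}. 1 / ?a k)" by simp
      also have "\<dots> \<le> (\<Sum>n\<in>{n1..<Suc k}. ?w n)"
        using inE ka by (intro sum_mono) (auto intro!: divide_left_mono mult_pos_pos)
      also have "\<dots> \<le> norm (sum ?w {n1..<Suc k})" by simp
      also have "\<dots> < \<epsilon> / 2" using n1N N by (intro N0) auto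
      finally show False by simp
    qed
    then show "\<forall>\<^sub>F k in sequentially. \<bar>\<Sum>i\<in>{k..<k + ?m k}. Z i \<omega>\<bar> \<le> \<tau> * ?d k"
      unfolding S_def eventually_sequentially by blast
  qed
qed

end

section \<open>Lower bounds for tails of sums\<close>

text \<open>
  The density on \<open>[R, R + 1]\<close> is at least its value at \<open>R + 1\<close>, and the normalising factor
  \<open>sqrt (2 * pi)\<close> is below \<open>exp 2\<close>.
\<close>
lemma std_normal_tail_gt:
  assumes R: "R \<ge> 0"
  shows "exp (- ((R + 1)\<^sup>2 / 2) - 2) < measure std_normal_distribution {R<..}"
proof -
  interpret real_distribution std_normal_distribution
    by (rule real_dist_normal_dist)
  let ?c = "std_normal_density (R + 1)"
  have "emeasure std_normal_distribution {R<..} =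
      (\<integral>\<^sup>+x. ennreal (std_normal_density x) * indicator {R<..} x \<partial>lborel)"
    by (subst emeasure_density) auto
  also have "\<dots> \<ge> (\<integral>\<^sup>+x. ennreal ?c * indicator {R<..R + 1} x \<partial>lborel)"
  proof (rule nn_integral_mono)
    fix x :: real
    have "?c \<le> std_normal_density x" if "R < x" "x \<le> R + 1"
      using that R by (auto simp: std_normal_density_def intro!: divide_right_mono power_mono)
    then show "ennreal ?c * indicator {R<..R + 1} x \<le>
        ennreal (std_normal_density x) * indicator {R<..} x"
      by (auto simp: indicator_def intro!: ennreal_leI)
  qed
  also have "(\<integral>\<^sup>+x. ennreal ?c * indicator {R<..R + 1} x \<partial>lborel) = ennreal ?c"
    by (subst nn_integral_cmult_indicator) auto
  finally have "?c \<le> measure std_normal_distribution {R<..}"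
    by (simp add: emeasure_eq_measure)
  moreover have "exp (- ((R + 1)\<^sup>2 / 2) - 2) < ?c"
  proof -
    have "sqrt (2 * pi) < sqrt 9" using pi_less_4 by (intro real_sqrt_less_mono) linarith
    also have "sqrt 9 = (3::real)" by (rule real_sqrt_unique) auto
    also have "3 \<le> exp (2::real)" using exp_ge_add_one_self[of 2] by simp
    finally have "sqrt (2 * pi) < exp 2" .
    then have "1 / exp 2 < 1 / sqrt (2 * pi)"
      by (intro divide_strict_left_mono mult_pos_pos) (auto simp: pi_gt_zero)
    from mult_strict_right_mono[OF this, of "exp (- ((R + 1)\<^sup>2 / 2))"]
    show ?thesis by (simp add: std_normal_density_def exp_diff)
  qed
  ultimately show ?thesis by linarith
qed

lemma isCont_cdf_std_normal: "isCont (cdf std_normal_distribution) x"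
proof -
  interpret real_distribution std_normal_distribution
    by (rule real_dist_normal_dist)
  have "emeasure std_normal_distribution {x} =
      (\<integral>\<^sup>+y. ennreal (std_normal_density y) * indicator {x} y \<partial>lborel)"
    by (subst emeasure_density) auto
  also have "\<dots> = 0"
    using AE_lborel_singleton[of x] by (subst nn_integral_0_iff_AE) (auto simp: indicator_def)
  finally show ?thesis
    by (simp add: isCont_cdf emeasure_eq_measure)
qed

context iid_sequence
begin

definition upper_tail :: "nat \<Rightarrow> real \<Rightarrow> real" where
  "upper_tail m x = prob {\<omega> \<in> space M. (\<Sum>i\<in>{0..<m}. Z i \<omega>) \<ge> x}"

lemma distr_window:
  "distr M borel (\<lambda>\<omega>. \<Sum>i\<in>{n..<n + m}. Z i \<omega>) = distr M borel (\<lambda>\<omega>. \<Sum>i\<in>{0..<m}. Z i \<omega>)"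
proof (induction m)
  case (Suc m)
  have step: "distr M borel (\<lambda>\<omega>. \<Sum>i\<in>{k..<k + Suc m}. Z i \<omega>) =
      convolution D (distr M borel (\<lambda>\<omega>. \<Sum>i\<in>{k..<k + m}. Z i \<omega>))" for k
  proof -
    have "indep_var borel (Z (k + m)) borel (\<lambda>\<omega>. \<Sum>i\<in>{k..<k + m}. Z i \<omega>)"
      by (intro indep_vars_sum indep_Z) auto
    from sum_indep_random_variable[OF this] show ?thesis
      by (simp add: distr_Z add.commute)
  qed
  show ?case using step[of n] step[of 0] Suc by simp
qed simp

lemma prob_window_ge: "prob {\<omega> \<in> space M. (\<Sum>i\<in>{n..<n + m}. Z i \<omega>) \<ge> x} = upper_tail m x"
proof -
  have "prob {\<omega> \<in> space M. (\<Sum>i\<in>{k..<k + m}. Z i \<omega>) \<ge> x} =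
      measure (distr M borel (\<lambda>\<omega>. \<Sum>i\<in>{k..<k + m}. Z i \<omega>)) {x..}" for k
    by (subst measure_distr) (auto intro!: arg_cong[where f=prob])
  from this[of n] this[of 0] distr_window[of n m] show ?thesis by (simp add: upper_tail_def)
qed

lemma upper_tail_antimono: "x \<le> y \<Longrightarrow> upper_tail m y \<le> upper_tail m x"
  unfolding upper_tail_def by (intro finite_measure_mono) auto

lemma upper_tail_nonneg: "upper_tail m x \<ge> 0"
  by (simp add: upper_tail_def)

text \<open>
  Adjacent windows are independent, and the law of a window sum depends on its size only. Iterating
  this bound reduces a long window to blocks that the central limit theorem can handle.
\<close>
lemma upper_tail_add: "upper_tail m x * upper_tail k y \<le> upper_tail (m + k) (x + y)"
proof -
  let ?A = "{0..<m}" and ?B = "{m..<m + k}"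
  define P where "P f \<longleftrightarrow> (\<Sum>i\<in>?A. f i) \<ge> x" for f :: "nat \<Rightarrow> real"
  define Q where "Q f \<longleftrightarrow> (\<Sum>i\<in>?B. f i) \<ge> y" for f :: "nat \<Rightarrow> real"
  have [measurable]: "Measurable.pred (PiM ?A (\<lambda>_. borel)) P"
      "Measurable.pred (PiM ?B (\<lambda>_. borel)) Q"
    unfolding P_def Q_def by measurable
  have restr: "P (\<lambda>i\<in>?A. Z i \<omega>) = P (\<lambda>i. Z i \<omega>)" "Q (\<lambda>i\<in>?B. Z i \<omega>) = Q (\<lambda>i. Z i \<omega>)" for \<omega>
    by (auto simp: P_def Q_def)
  have "upper_tail m x * upper_tail k y = prob {\<omega> \<in> space M. P (\<lambda>i. Z i \<omega>) \<and> Q (\<lambda>i. Z i \<omega>)}"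
    using prob_disjoint_windows[of ?A ?B P Q] prob_window_ge[where n=m and m=k and x=y]
    unfolding restr by (simp add: P_def Q_def upper_tail_def)
  also have "\<dots> \<le> upper_tail (m + k) (x + y)"
    unfolding upper_tail_def
  proof (rule finite_measure_mono)
    show "{\<omega> \<in> space M. P (\<lambda>i. Z i \<omega>) \<and> Q (\<lambda>i. Z i \<omega>)} \<subseteq> {\<omega> \<in> space M. x + y \<le>
        (\<Sum>i = 0..<m + k. Z i \<omega>)}"
    proof safe
      fix \<omega> assume "P (\<lambda>i. Z i \<omega>)" "Q (\<lambda>i. Z i \<omega>)"
      moreover have "(\<Sum>i = 0..<m + k. Z i \<omega>) = (\<Sum>i\<in>?A. Z i \<omega>) + (\<Sum>i\<in>?B. Z i \<omega>)"
        by (simp add: sum.atLeastLessThan_concat)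
      ultimately show "x + y \<le> (\<Sum>i = 0..<m + k. Z i \<omega>)" by (simp add: P_def Q_def)
    qed
  qed measurable
  finally show ?thesis .
qed

lemma upper_tail_power: "upper_tail l x ^ q \<le> upper_tail (q * l) (real q * x)"
proof (induction q)
  case 0
  then show ?case by (simp add: upper_tail_def prob_space)
next
  case (Suc q)
  have "upper_tail l x ^ Suc q \<le> upper_tail l x * upper_tail (q * l) (real q * x)"
    using Suc by (simp add: mult_left_mono upper_tail_nonneg)
  also have "\<dots> \<le> upper_tail (l + q * l) (x + real q * x)" by (rule upper_tail_add)
  finally show ?case by (simp add: algebra_simps)
qed

lemma upper_tail_half:
  assumes z: "z > 0" and r: "2 * (real r * \<sigma>\<^sup>2) \<le> z\<^sup>2"
  shows "upper_tail r (- z) \<ge> 1 / 2"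
proof -
  let ?S = "\<lambda>\<omega>. \<Sum>i\<in>{0..<r}. Z i \<omega>"
  have "1 - upper_tail r (- z) = prob {\<omega> \<in> space M. \<not> ?S \<omega> \<ge> - z}"
    unfolding upper_tail_def by (subst prob_neg) auto
  also have "\<dots> \<le> prob {\<omega> \<in> space M. \<bar>?S \<omega>\<bar> \<ge> z}"
    by (intro finite_measure_mono) auto
  also have "\<dots> \<le> real r * \<sigma>\<^sup>2 / z\<^sup>2"
    using chebyshev_sum[of "{0..<r}" z] z by simp
  also have "\<dots> \<le> 1 / 2" using r z by (simp add: field_simps)
  finally show ?thesis by simp
qed

lemma upper_tail_clt:
  assumes \<sigma>: "\<sigma> > 0" and R: "R \<ge> 0"
  shows "eventually (\<lambda>l. upper_tail l (R * \<sigma> * sqrt (real l)) \<ge>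
      exp (- ((R + 1)\<^sup>2 / 2) - 2)) sequentially"
proof -
  interpret N: real_distribution std_normal_distribution
    by (rule real_dist_normal_dist)
  let ?T = "\<lambda>n \<omega>. (\<Sum>i<n. Z i \<omega>) / sqrt (real n * \<sigma>\<^sup>2)"
  have mean: "expectation (Z n) = 0" for n
    using expectation_Z[of "\<lambda>x. x" n] mean_zero by simp
  have sq: "integrable M (\<lambda>\<omega>. (Z n \<omega>)\<^sup>2)" for n
    using integrable_D_Z_iff[of "\<lambda>x. x\<^sup>2" n] square_integrable by simp
  have var: "expectation (\<lambda>\<omega>. (Z n \<omega> - expectation (Z n))\<^sup>2) = \<sigma>\<^sup>2" for n
    using expectation_Z[of "\<lambda>x. x\<^sup>2" n] variance mean by simp
  have "weak_conv_m (\<lambda>n. distr M borel (?T n)) std_normal_distribution"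
    by (rule central_limit_theorem_zero_mean[OF indep mean \<sigma> sq var distr_Z])
  then have "(\<lambda>n. cdf (distr M borel (?T n)) R) \<longlonglongrightarrow> cdf std_normal_distribution R"
    unfolding weak_conv_m_def weak_conv_def using isCont_cdf_std_normal by blast
  then have "(\<lambda>n. 1 - cdf (distr M borel (?T n)) R) \<longlonglongrightarrow> 1 - cdf std_normal_distribution R"
    by (intro tendsto_intros)
  moreover have "1 - cdf std_normal_distribution R = measure std_normal_distribution {R<..}"
    using N.prob_compl[of "{..R}"] by (simp add: cdf_def Compl_eq_Diff_UNIV[symmetric])
  ultimately have "eventually (\<lambda>n. exp (- ((R + 1)\<^sup>2 / 2) - 2) <
      1 - cdf (distr M borel (?T n)) R) sequentially"
    using std_normal_tail_gt[OF R] by (auto intro: order_tendstoD(1))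
  then show ?thesis
    using eventually_gt_at_top[of 0]
  proof eventually_elim
    case (elim n)
    have "1 - cdf (distr M borel (?T n)) R = 1 - prob {\<omega> \<in> space M. ?T n \<omega> \<le> R}"
      unfolding cdf_def by (subst measure_distr) (auto intro!: arg_cong[where f=prob])
    also have "\<dots> = prob {\<omega> \<in> space M. \<not> ?T n \<omega> \<le> R}"
      by (subst prob_neg) auto
    also have "\<dots> \<le> upper_tail n (R * \<sigma> * sqrt (real n))"
      unfolding upper_tail_def
    proof (intro finite_measure_mono)
      show "{\<omega> \<in> space M. \<not> ?T n \<omega> \<le> R} \<subseteq> {\<omega> \<in> space M. R * \<sigma> * sqrt (real n) \<le>
          (\<Sum>i = 0..<n. Z i \<omega>)}"
        using elim \<sigma> by (auto simp: real_sqrt_mult field_simps atLeast0LessThan)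
    qed measurable
    finally show ?case using elim by simp
  qed
qed

end
text \<open>
  With \<open>a\<close> for the window length and \<open>L = ln (ln n)\<close>: the sum of the blocks, which cover at least
  \<open>a - 2 - \<theta> * L\<close> of the window, overshoots the threshold by the factor \<open>sqrt (1 + \<epsilon>)\<close>. This
  leaves room for the possible loss in the remainder, which has order \<open>sqrt L\<close> only.
\<close>
lemma block_split_asymptotics:
  fixes p \<epsilon> t \<theta> s :: real
  assumes "p > 0" "\<epsilon> > 0" "t > 0" "\<theta> > 0" "s > 0"
  shows "eventually (\<lambda>n::nat. t * sqrt (2 * (p + 1) * window_length p n * ln (ln (real n))) \<le>
      sqrt ((1 + \<epsilon>) * (2 * (p + 1)) * t\<^sup>2 * ln (ln (real n)) * (window_length p n - 2 - \<theta> *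
          ln (ln (real n))))
       - s * sqrt (2 * (\<theta> * ln (ln (real n)) + 1))) at_top"
proof -
  let ?L = "\<lambda>n::nat. ln (ln (real n))"
  define c where "c = 2 * (p + 1)"
  define f where "f n =
      sqrt ((1 + \<epsilon>) * c * t\<^sup>2 * ((window_length p n - 2 - \<theta> * ?L n) / window_length p n)) -
    s * sqrt (2 * ((\<theta> * ?L n + 1) / (window_length p n * ?L n)))" for n
  have "c > 0" using assms by (simp add: c_def)
  have "(\<lambda>n. (window_length p n - 2 - \<theta> * ?L n) / window_length p n) \<longlonglongrightarrow> 1"
    using assms unfolding window_length_def by real_asymp
  moreover have "(\<lambda>n. (\<theta> * ?L n + 1) / (window_length p n * ?L n)) \<longlonglongrightarrow> 0"
    using assms unfolding window_length_def by real_asymp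
  ultimately have "f \<longlonglongrightarrow> sqrt ((1 + \<epsilon>) * c * t\<^sup>2 * 1) - s * sqrt (2 * 0)"
    unfolding f_def by (intro tendsto_intros)
  moreover have "t * sqrt c < sqrt ((1 + \<epsilon>) * c * t\<^sup>2 * 1) - s * sqrt (2 * 0)"
    using assms \<open>c > 0\<close> by (simp add: real_sqrt_mult)
  ultimately have "eventually (\<lambda>n. t * sqrt c < f n) at_top"
    by (rule order_tendstoD(1))
  moreover have "eventually (\<lambda>n. window_length p n > 0) at_top"
    using window_length_at_top[OF assms(1)] by (simp add: filterlim_at_top_dense)
  moreover have "eventually (\<lambda>n. ?L n > 0) at_top" by real_asymp
  ultimately show ?thesis
  proof eventually_elim
    case (elim n)
    define a where "a = window_length p n"
    define L where "L = ?L n"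
    have P: "a > 0" "L > 0" using elim by (simp_all add: a_def L_def)
    have "t * sqrt c * sqrt (a * L) \<le> f n * sqrt (a * L)"
      using elim(1) P by (intro mult_right_mono) auto
    also have "\<dots> = sqrt ((1 + \<epsilon>) * c * t\<^sup>2 * ((a - 2 - \<theta> * L) / a) * (a * L)) -
        s * sqrt (2 * ((\<theta> * L + 1) / (a * L)) * (a * L))"
      unfolding f_def a_def[symmetric] L_def[symmetric] real_sqrt_mult[of _ "a * L"]
          by (simp only: left_diff_distrib mult.assoc)
    also have "(1 + \<epsilon>) * c * t\<^sup>2 * ((a - 2 - \<theta> * L) / a) * (a * L) =
        (1 + \<epsilon>) * c * t\<^sup>2 * L * (a - 2 - \<theta> * L)"
      using P by simp
    also have "2 * ((\<theta> * L + 1) / (a * L)) * (a * L) = 2 * (\<theta> * L + 1)"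
      using P by simp
    also have "t * sqrt c * sqrt (a * L) = t * sqrt (c * a * L)"
      by (simp add: real_sqrt_mult)
    finally show ?case by (simp only: a_def L_def c_def)
  qed
qed

lemma block_length_at_top:
  assumes "p > 0" "\<theta> > 0"
  shows "filterlim (\<lambda>n::nat. (window_length p n - 1) / (\<theta> * ln (ln (real n)) + 1) - 1)
      at_top at_top"
  using assms unfolding window_length_def by real_asymp

context iid_sequence
begin

text \<open>
  Up to a constant, the left-hand side is \<open>(ln n)^(- (p + 1))\<close>. The number \<open>q\<close> of blocks is
  \<open>\<theta> * ln (ln n)\<close> rounded up, where \<open>\<theta>\<close> is chosen such that \<open>q\<close> blocks, each exceeding \<open>R\<close>
  standard deviations, add up to slightly more than \<open>t * norming p n\<close>. One block succeeds with
  probability at least \<open>exp (- K)\<close> by the central limit theorem, so \<open>\<theta> * K \<le> p + 1\<close> is what is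
  needed. Since \<open>\<theta> * K\<close> tends to \<open>(p + 1) (1 + \<epsilon>) t^2 / \<sigma>^2\<close> for large \<open>R\<close>, this can be achieved
  because \<open>t < \<sigma>\<close>.
\<close>
lemma upper_tail_window_ge:
  assumes p: "p > 0" and t: "0 < t" "t < \<sigma>"
  shows "\<exists>c>0. \<forall>\<^sub>F n in sequentially.
    c * window_length p n * (1 / (real n * ln (real n))) \<le>
        upper_tail (window_size p n) (t * norming p n)"
proof -
  let ?L = "\<lambda>n::nat. ln (ln (real n))"
  have \<sigma>: "\<sigma> > 0" using t by simp
  define \<rho> where "\<rho> = t\<^sup>2 / \<sigma>\<^sup>2"
  have \<rho>: "\<rho> > 0" "\<rho> < 1"
    using t power_strict_mono[of t \<sigma> 2] by (auto simp: \<rho>_def)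
  define \<epsilon> where "\<epsilon> = (1 / \<rho> - 1) / 2"
  have \<epsilon>: "\<epsilon> > 0" "(1 + \<epsilon>) * \<rho> < 1"
    using \<rho> by (auto simp: \<epsilon>_def field_simps)
  have "((\<lambda>R::real. (1 + \<epsilon>) * \<rho> * (((R + 1)\<^sup>2 + 4) / R\<^sup>2)) \<longlongrightarrow> (1 + \<epsilon>) * \<rho> * 1) at_top"
    by (intro tendsto_mult tendsto_const) real_asymp
  then have "eventually (\<lambda>R::real. (1 + \<epsilon>) * \<rho> * (((R + 1)\<^sup>2 + 4) / R\<^sup>2) < 1 \<and> R > 0) at_top"
    using \<epsilon> by (intro eventually_conj eventually_gt_at_top order_tendstoD(2)) auto
  then obtain R where R: "(1 + \<epsilon>) * \<rho> * (((R + 1)\<^sup>2 + 4) / R\<^sup>2) < 1" "R > 0"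
    using eventually_happens by fastforce
  define \<theta> where "\<theta> = (1 + \<epsilon>) * (2 * (p + 1)) * t\<^sup>2 / (\<sigma> * R)\<^sup>2"
  have \<theta>: "\<theta> > 0" using \<epsilon> p t R by (simp add: \<theta>_def)
  have \<theta>R: "(\<sigma> * R)\<^sup>2 * \<theta> = (1 + \<epsilon>) * (2 * (p + 1)) * t\<^sup>2"
    using \<sigma> R by (simp add: \<theta>_def)
  define K where "K = (R + 1)\<^sup>2 / 2 + 2"
  have "\<theta> * K = (p + 1) * ((1 + \<epsilon>) * \<rho> * (((R + 1)\<^sup>2 + 4) / R\<^sup>2))"
    using \<sigma> R by (simp add: \<theta>_def K_def \<rho>_def field_simps power_mult_distrib)
  also have "\<dots> \<le> (p + 1) * 1" using R p by (intro mult_left_mono) auto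
  finally have \<theta>K: "\<theta> * K \<le> p + 1" by simp
  have K: "K > 0" by (auto simp: K_def intro: add_nonneg_pos)
  obtain l0 where l0: "\<And>l. l \<ge> l0 \<Longrightarrow> exp (- K) \<le> upper_tail l (R * \<sigma> * sqrt (real l))"
    using upper_tail_clt[OF \<sigma>, of R] R(2) by (auto simp: eventually_at_top_linorder K_def)
  define c where "c = exp (- K) / 2"
  have "\<forall>\<^sub>F n in sequentially.
    c * window_length p n * (1 / (real n * ln (real n))) \<le>
        upper_tail (window_size p n) (t * norming p n)"
  proof -
    have "eventually (\<lambda>n::nat. ?L n > 0) at_top" "eventually (\<lambda>n::nat. ln (real n) > 1) at_top"
      by real_asymp+
    moreover have "eventually (\<lambda>n. window_length p n > 2 + \<theta> * ?L n) at_top"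
      using p \<theta> unfolding window_length_def by real_asymp
    moreover note block_split_asymptotics[OF p \<epsilon>(1) t(1) \<theta> \<sigma>]
    moreover have "eventually (\<lambda>n. (window_length p n - 1) / (\<theta> * ?L n + 1) - 1 \<ge> real l0) at_top"
      using block_length_at_top[OF p \<theta>] by (simp add: filterlim_at_top)
    ultimately show ?thesis
    proof eventually_elim
      case (elim n)
      define L where "L = ?L n"
      define a where "a = window_length p n"
      define m where "m = window_size p n"
      define q where "q = nat \<lceil>\<theta> * L\<rceil>"
      define l where "l = m div q"
      define r where "r = m mod q"
      define z where "z = \<sigma> * sqrt (2 * real q)"
      have \<theta>L: "\<theta> * L > 0" using \<theta> elim(1) by (simp add: L_def)
      have q: "\<theta> * L \<le> real q" "real q < \<theta> * L + 1" "q > 0"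
        unfolding q_def using \<theta>L by linarith+
      have m: "m = q * l + r" "r < q" using q(3) by (simp_all add: l_def r_def)
      have am: "a < real m + 1" using window_size_bounds[of p n] by (simp add: a_def m_def)
      have m': "real m = real q * real l + real r" by (simp add: m(1))
      have ql: "real q * real l \<ge> a - 2 - \<theta> * L"
        using m' m(2) am q(2) by linarith
      have "l \<ge> l0"
      proof -
        have "a - 1 < real q * (real l + 1)"
          using m' m(2) am by (simp add: algebra_simps)
        also have "\<dots> \<le> (\<theta> * L + 1) * (real l + 1)"
          using q by (intro mult_right_mono) auto
        finally have "(a - 1) / (\<theta> * L + 1) < real l + 1"
          using \<theta>L by (simp add: field_simps)
        then show ?thesis using elim(5) by (simp add: a_def L_def)
      qed
      note l_tail = l0[OF this]
      have z: "z > 0" "2 * (real r * \<sigma>\<^sup>2) \<le> z\<^sup>2"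
        using \<sigma> q m(2) by (auto simp: z_def power_mult_distrib intro!: mult_right_mono)
      have threshold: "t * norming p n \<le> real q * (R * \<sigma> * sqrt (real l)) + (- z)"
      proof -
        have "t * norming p n \<le>
            sqrt ((1 + \<epsilon>) * (2 * (p + 1)) * t\<^sup>2 * L * (a - 2 - \<theta> * L)) - \<sigma> * sqrt (2 * (\<theta> * L + 1))"
          using elim(4) by (simp add: norming_def a_def L_def)
        also have "sqrt ((1 + \<epsilon>) * (2 * (p + 1)) * t\<^sup>2 * L * (a - 2 - \<theta> * L)) =
            \<sigma> * R * sqrt ((\<theta> * L) * (a - 2 - \<theta> * L))"
          unfolding \<theta>R[symmetric] using \<sigma> R by (simp add: real_sqrt_mult mult_ac)
        also have "\<sigma> * R * sqrt ((\<theta> * L) * (a - 2 - \<theta> * L)) \<le>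
            \<sigma> * R * sqrt (real q * (real q * real l))"
          using \<sigma> R q \<theta>L ql elim(3)
          by (intro mult_left_mono real_sqrt_le_mono mult_mono) (auto simp: a_def L_def)
        also have "\<dots> = real q * (R * \<sigma> * sqrt (real l))"
          by (simp add: real_sqrt_mult mult_ac)
        finally have "t * norming p n \<le>
            real q * (R * \<sigma> * sqrt (real l)) - \<sigma> * sqrt (2 * (\<theta> * L + 1))"
          by simp
        moreover have "\<sigma> * sqrt (2 * (\<theta> * L + 1)) \<ge> z"
          unfolding z_def using \<sigma> q by (intro mult_left_mono real_sqrt_le_mono) auto
        ultimately show ?thesis by linarith
      qed
      have "c * (a * (1 / (real n * ln (real n)))) = c * ln (real n) powr (- (p + 1))"
      proof -
        have "real n > 0" using elim(2) by (cases "n = 0") auto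
        moreover have "ln (real n) powr (- (p + 1)) = 1 / (ln (real n) powr p * ln (real n))"
          using elim(2) unfolding powr_minus powr_add by (simp add: divide_inverse)
        ultimately show ?thesis using elim(2) by (simp add: a_def window_length_def)
      qed
      also have "\<dots> = c * exp (- ((p + 1) * L))"
        using elim(2) by (simp add: powr_def L_def algebra_simps)
      also have "\<dots> \<le> c * exp (- (\<theta> * K * L))"
        using \<theta>K elim(1) by (intro mult_left_mono) (auto simp: c_def L_def)
      also have "\<dots> = exp (- (K * (\<theta> * L + 1))) * (1 / 2)"
        by (simp add: c_def exp_add[symmetric] algebra_simps)
      also have "\<dots> \<le> exp (- (K * real q)) * (1 / 2)"
        using K q by simp
      also have "\<dots> = exp (- K) ^ q * (1 / 2)"
        by (simp add: exp_of_nat_mult[symmetric] mult.commute)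
      also have "\<dots> \<le> upper_tail l (R * \<sigma> * sqrt (real l)) ^ q * upper_tail r (- z)"
        by (intro mult_mono power_mono l_tail upper_tail_half z) (auto simp: upper_tail_nonneg)
      also have "\<dots> \<le> upper_tail (q * l) (real q * (R * \<sigma> * sqrt (real l))) * upper_tail r (- z)"
        by (intro mult_right_mono upper_tail_power upper_tail_nonneg)
      also have "\<dots> \<le> upper_tail m (real q * (R * \<sigma> * sqrt (real l)) + (- z))"
        unfolding m(1) by (rule upper_tail_add)
      also have "\<dots> \<le> upper_tail m (t * norming p n)"
        by (rule upper_tail_antimono[OF threshold])
      finally show ?case by (simp add: a_def m_def mult.assoc)
    qed
  qed
  moreover have "c > 0" by (simp add: c_def)
  ultimately show ?thesis by blast
qed

end

section \<open>The lower bound\<close>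

text \<open>
  The probability that none of the events with index from \<open>k\<close> to \<open>n\<close> occurs is a product of
  factors \<open>1 - P i \<le> exp (- P i)\<close>, which tends to 0 when the series of the \<open>P i\<close> diverges.
\<close>
lemma (in prob_space) borel_cantelli_second:
  fixes Y :: "nat \<Rightarrow> 'a \<Rightarrow> real"
  assumes ind: "indep_vars (\<lambda>_. borel) Y UNIV"
    and div: "\<not> summable (\<lambda>i. prob {\<omega> \<in> space M. Y i \<omega> \<ge> y i})"
  shows "AE \<omega> in M. \<forall>k. \<exists>i\<ge>k. Y i \<omega> \<ge> y i"
proof -
  have [measurable]: "Y i \<in> borel_measurable M" for i
    using ind by (auto simp: indep_vars_def)
  define P where "P i = prob {\<omega> \<in> space M. Y i \<omega> \<ge> y i}" for i
  have "AE \<omega> in M. \<exists>i\<ge>k. Y i \<omega> \<ge> y i" for k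
  proof -
    let ?N = "{\<omega> \<in> space M. \<forall>i\<ge>k. Y i \<omega> < y i}"
    have bound: "prob ?N \<le> exp (- (\<Sum>i\<in>{k..<n}. P i))" if n: "n > k" for n
    proof -
      have "prob ?N \<le> prob (\<Inter>i\<in>{k..<n}. Y i -` {..<y i} \<inter> space M)"
      proof (rule finite_measure_mono)
        show "(\<Inter>i\<in>{k..<n}. Y i -` {..<y i} \<inter> space M) \<in> events"
          using n by (intro sets.finite_INT) auto
      qed auto
      also have "\<dots> = (\<Prod>i\<in>{k..<n}. prob (Y i -` {..<y i} \<inter> space M))"
        using n by (intro indep_varsD[OF ind]) auto
      also have "\<dots> = (\<Prod>i\<in>{k..<n}. 1 - P i)"
      proof (rule prod.cong)
        fix i
        have "1 - P i = prob {\<omega> \<in> space M. \<not> Y i \<omega> \<ge> y i}"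
          unfolding P_def by (subst prob_neg) auto
        then show "prob (Y i -` {..<y i} \<inter> space M) = 1 - P i"
          by (simp add: not_le vimage_def Int_def conj_commute)
      qed simp
      also have "\<dots> \<le> (\<Prod>i\<in>{k..<n}. exp (- P i))"
        by (intro prod_mono)
          (auto simp: P_def intro: exp_ge_add_one_self[of "- P i" for i, simplified])
      also have "\<dots> = exp (- (\<Sum>i\<in>{k..<n}. P i))"
        by (simp add: exp_sum[symmetric] sum_negf)
      finally show ?thesis .
    qed
    have "prob ?N \<le> 0"
    proof (rule ccontr)
      assume "\<not> prob ?N \<le> 0"
      then have N: "prob ?N > 0" by simp
      have "(\<Sum>i\<in>{k..<n}. P i) \<le> max 0 (- ln (prob ?N))" for n
      proof (cases "n > k")
        case True
        have "ln (prob ?N) \<le> ln (exp (- (\<Sum>i\<in>{k..<n}. P i)))"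
          using bound[OF True] N by (subst ln_le_cancel_iff) auto
        then have "ln (prob ?N) \<le> - (\<Sum>i\<in>{k..<n}. P i)" by simp
        then show ?thesis by linarith
      qed simp
      then have "summable (\<lambda>i. P (i + k))"
      proof (intro bounded_imp_summable)
        fix n
        have "(\<Sum>i\<le>n. P (i + k)) = (\<Sum>i\<in>{k..<Suc n + k}. P i)"
          using sum.shift_bounds_nat_ivl[of P 0 k "Suc n"]
              by (simp add: lessThan_Suc_atMost[symmetric] atLeast0LessThan)
        also have "\<dots> \<le> max 0 (- ln (prob ?N))" by fact
        finally show "(\<Sum>i\<le>n. P (i + k)) \<le> max 0 (- ln (prob ?N))" .
      qed (simp add: P_def)
      then have "summable P" by (simp only: summable_iff_shift)
      then show False using div unfolding P_def by simp
    qed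
    then have "prob ?N = 0" by (simp add: antisym)
    then have "AE \<omega> in M. \<not> (\<forall>i\<ge>k. Y i \<omega> < y i)"
      by (subst (asm) prob_eq_0) (auto)
    then show ?thesis by eventually_elim (auto simp: not_less)
  qed
  then show ?thesis by (simp add: AE_all_countable)
qed

text \<open>
  Each window begins where the preceding one ends, so these windows partition the integers from
  \<open>N\<close> on.
\<close>
primrec window_start :: "real \<Rightarrow> nat \<Rightarrow> nat \<Rightarrow> nat" where
  "window_start p N 0 = N"
| "window_start p N (Suc i) = window_start p N i + window_size p (window_start p N i)"

context iid_sequence
begin

text \<open>
  The windows tile the integers from \<open>N\<close> on, and the success probability of the window at \<open>v i\<close> is
  at least a constant times the number of its elements times \<open>1 / (v i * ln (v i))\<close>. The series of
  these probabilities therefore dominates \<open>\<Sum>n. 1 / (n * ln n)\<close>, which diverges.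
\<close>
lemma window_lower_bound:
  assumes p: "p > 0" and t: "0 < t" "t < \<sigma>"
  shows "AE \<omega> in M. \<exists>\<^sub>F n in sequentially. t * norming p n \<le> (\<Sum>i\<in>{n..<n + window_size p n}. Z i \<omega>)"
proof -
  obtain c where c: "c > 0" and tail: "\<forall>\<^sub>F n in sequentially.
      c * window_length p n * (1 / (real n * ln (real n))) \<le>
          upper_tail (window_size p n) (t * norming p n)"
    using upper_tail_window_ge[OF p t] by blast
  note tail
  moreover have "eventually (\<lambda>n. window_length p n > 1) at_top"
    using window_length_at_top[OF p] by (simp add: filterlim_at_top_dense)
  moreover have "eventually (\<lambda>n::nat. ln (real n) > 0) at_top" by real_asymp
  ultimately have "eventually (\<lambda>n. c * window_length p n * (1 / (real n * ln (real n))) \<le>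
      upper_tail (window_size p n) (t * norming p n)
      \<and> window_length p n > 1 \<and> ln (real n) > 0) at_top"
    by eventually_elim auto
  then obtain N where N: "\<And>n. n \<ge> N \<Longrightarrow> c * window_length p n * (1 / (real n * ln (real n))) \<le>
      upper_tail (window_size p n) (t * norming p n)"
    "\<And>n. n \<ge> N \<Longrightarrow> window_length p n > 1" "\<And>n. n \<ge> N \<Longrightarrow> ln (real n) > 0"
    by (auto simp: eventually_at_top_linorder)
  define v where "v = window_start p N"
  have v_Suc: "v (Suc i) = v i + window_size p (v i)" for i by (simp add: v_def)
  have vN: "v i \<ge> N" for i by (induction i) (auto simp: v_def)
  have count: "window_size p (v i) \<ge> 1" for i
    using N(2)[OF vN[of i]] window_size_bounds[of p "v i"] by linarith
  have v_strict: "strict_mono v"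
    using count by (intro strict_mono_Suc_iff[THEN iffD2]) (auto simp: v_Suc intro: Suc_le_lessD)
  define Y where "Y i \<omega> = (\<Sum>j\<in>{v i..<v (Suc i)}. Z j \<omega>)" for i \<omega>
  have indY: "indep_vars (\<lambda>_. borel) Y UNIV"
  proof -
    have disj: "disjoint_family_on (\<lambda>i. {v i..<v (Suc i)}) UNIV"
      unfolding disjoint_family_on_def
    proof (intro ballI impI)
      fix i j :: nat assume "i \<noteq> j"
      then have "v (Suc i) \<le> v j \<or> v (Suc j) \<le> v i"
        using strict_mono_less_eq[OF v_strict] by (metis Suc_leI linorder_neqE_nat)
      then show "{v i..<v (Suc i)} \<inter> {v j..<v (Suc j)} = {}" by auto
    qed
    have "indep_vars (\<lambda>i. borel) (\<lambda>i \<omega>. \<Sum>j\<in>{v i..<v (Suc i)}. (\<lambda>j\<in>{v i..<v (Suc i)}. Z j \<omega>) j) UNIV"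
      by (rule indep_vars_compose2[OF indep_vars_restrict[OF indep _ disj]]) auto
    then show ?thesis by (simp add: Y_def[abs_def])
  qed
  have PY: "prob {\<omega> \<in> space M. Y i \<omega> \<ge> t * norming p (v i)} =
      upper_tail (window_size p (v i)) (t * norming p (v i))" for i
    unfolding Y_def v_Suc by (rule prob_window_ge)
  have "\<not> summable (\<lambda>i. prob {\<omega> \<in> space M. Y i \<omega> \<ge> t * norming p (v i)})"
  proof
    let ?P = "\<lambda>i. prob {\<omega> \<in> space M. Y i \<omega> \<ge> t * norming p (v i)}"
    let ?g = "\<lambda>n::nat. 1 / (real n * ln (real n))"
    assume sum: "summable ?P"
    have block: "c * (\<Sum>n\<in>{v i..<v (Suc i)}. ?g n) \<le> ?P i" for i
    proof -
      have pos: "ln (real (v i)) > 0" "real (v i) > 0"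
        using N(3)[OF vN[of i]] by (auto intro: Nat.gr0I)
      have "(\<Sum>n\<in>{v i..<v (Suc i)}. ?g n) \<le> (\<Sum>n\<in>{v i..<v (Suc i)}. ?g (v i))"
      proof (rule sum_mono)
        fix n assume n: "n \<in> {v i..<v (Suc i)}"
        then have "real (v i) \<le> real n" by simp
        moreover from this have "ln (real (v i)) \<le> ln (real n)" using pos by simp
        ultimately show "?g n \<le> ?g (v i)"
          using pos by (intro divide_left_mono mult_mono mult_pos_pos) auto
      qed
      also have "\<dots> = real (window_size p (v i)) * ?g (v i)" by (simp add: v_Suc)
      also have "\<dots> \<le> window_length p (v i) * ?g (v i)"
        using window_size_bounds[of p "v i"] pos by (intro mult_right_mono) auto
      finally have "c * (\<Sum>n\<in>{v i..<v (Suc i)}. ?g n) \<le> c * window_length p (v i) * ?g (v i)"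
        using c unfolding mult.assoc by (intro mult_left_mono) auto
      also have "\<dots> \<le> ?P i" unfolding PY by (rule N(1)[OF vN])
      finally show ?thesis .
    qed
    have g_nonneg: "?g n \<ge> 0" if "n \<ge> N" for n using N(3)[OF that] by simp
    have "summable (\<lambda>n. ?g (n + N))"
    proof (rule bounded_imp_summable)
      fix n
      have blocks: "(\<Sum>k\<in>{N..<v I}. ?g k) = (\<Sum>i<I. \<Sum>k\<in>{v i..<v (Suc i)}. ?g k)" for I
      proof (induction I)
        case (Suc I)
        have "(\<Sum>k\<in>{N..<v (Suc I)}. ?g k) = (\<Sum>k\<in>{N..<v I}. ?g k) + (\<Sum>k\<in>{v I..<v (Suc I)}. ?g k)"
          using vN[of I] by (intro sum.atLeastLessThan_concat[symmetric]) (auto simp: v_Suc)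
        then show ?case using Suc by simp
      qed (simp add: v_def)
      have "N + Suc n \<le> v (Suc n)"
      proof (induction n)
        case 0 then show ?case using count[of 0] by (simp add: v_Suc) (simp add: v_def)
      next
        case (Suc n) then show ?case using count[of "Suc n"] v_Suc[of "Suc n"] by linarith
      qed
      have "(\<Sum>k\<le>n. ?g (k + N)) = (\<Sum>k\<in>{N..<N + Suc n}. ?g k)"
        using sum.shift_bounds_nat_ivl[of ?g 0 N "Suc n"]
        by (simp add: lessThan_Suc_atMost[symmetric] atLeast0LessThan add.commute)
      also have "\<dots> \<le> (\<Sum>k\<in>{N..<v (Suc n)}. ?g k)"
        using \<open>N + Suc n \<le> _\<close> by (intro sum_mono2) (auto intro: g_nonneg)
      also have "\<dots> \<le> (\<Sum>i<Suc n. ?P i / c)"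
        unfolding blocks using block c by (intro sum_mono) (simp add: field_simps)
      also have "\<dots> \<le> (\<Sum>i. ?P i / c)"
        using c by (intro sum_le_suminf summable_divide sum) auto
      finally show "(\<Sum>k\<le>n. ?g (k + N)) \<le> (\<Sum>i. ?P i / c)" .
    qed (rule g_nonneg, simp)
    then have "summable ?g" by (rule summable_iff_shift[of ?g N, THEN iffD1])
    then show False using not_summable_inverse_n_ln by blast
  qed
  from borel_cantelli_second[OF indY this]
  show ?thesis
  proof eventually_elim
    fix \<omega> assume *: "\<forall>k. \<exists>i\<ge>k. t * norming p (v i) \<le> Y i \<omega>"
    show "\<exists>\<^sub>F n in sequentially. t * norming p n \<le> (\<Sum>i\<in>{n..<n + window_size p n}. Z i \<omega>)"
      unfolding frequently_sequentially
    proof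
      fix k
      obtain i where i: "i \<ge> k" "t * norming p (v i) \<le> Y i \<omega>" using * by blast
      have "k \<le> v i" using i(1) strict_mono_imp_increasing[OF v_strict, of i] by simp
      then show "\<exists>n\<ge>k. t * norming p n \<le> (\<Sum>i\<in>{n..<n + window_size p n}. Z i \<omega>)"
        using i(2) by (auto simp: Y_def v_Suc)
    qed
  qed
qed

end

section \<open>The limit superior\<close>

theorem corollary2p1:
  fixes M :: "'a measure"
    and X :: "'a \<Rightarrow> real"
    and Xs :: "nat \<Rightarrow> 'a \<Rightarrow> real"
    and \<sigma> p :: real
  assumes "prob_space M"
    and "X \<in> borel_measurable M"
    and "prob_space.indep_vars M (\<lambda>_. borel) Xs {1..}"
    and "\<And>n. n \<ge> 1 \<Longrightarrow> distr M borel (Xs n) = distr M borel X"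
    and "integrable M X"
    and "prob_space.expectation M X = 0"
    and "integrable M (\<lambda>\<omega>. (X \<omega>)\<^sup>2)"
    and "prob_space.variance M X = \<sigma>\<^sup>2"
    and "\<sigma> \<ge> 0"
    and "p > 0"
    and "integrable M (\<lambda>\<omega>. (X \<omega>)\<^sup>2 *
           ((log_plus \<bar>X \<omega>\<bar>) powr p / log_plus (log_plus \<bar>X \<omega>\<bar>)))"
  shows "AE \<omega> in M.
           limsup (\<lambda>n. ereal (window_sum Xs n (real n / (ln (real n)) powr p) \<omega> /
             sqrt (2 * (p + 1) * (real n / (ln (real n)) powr p) * ln (ln (real n)))))
           = ereal \<sigma>"
proof -
  interpret prob_space M by fact
  note [measurable] = assms(2)
  define Z where "Z i = Xs (Suc i)" for i
  define D where "D = distr M borel X"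
  have sq: "integrable D (\<lambda>x. x\<^sup>2)"
    using assms(7) by (simp add: D_def integrable_distr_eq)
  have mom: "integrable D (moment_weight p)"
    using assms(11) by (simp add: D_def integrable_distr_eq moment_weight_def[abs_def])
  interpret iid_sequence M Z D \<sigma>
  proof
    have "indep_vars (\<lambda>i. borel) (\<lambda>i. Xs (Suc i)) UNIV"
    proof -
      have "indep_vars (\<lambda>i. borel) (\<lambda>i \<omega>. (\<lambda>j\<in>{Suc i}. Xs j \<omega>) (Suc i)) UNIV"
        by (rule indep_vars_compose2[OF indep_vars_restrict[OF assms(3)]]) (auto simp:
          disjoint_family_on_def)
      then show ?thesis by simp
    qed
    then show "indep_vars (\<lambda>_. borel) Z UNIV" by (simp add: Z_def[abs_def])
    show "distr M borel (Z n) = D" for n using assms(4)[of "Suc n"] by (simp add: Z_def D_def)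
    show "integrable D (\<lambda>x. x\<^sup>2)" by (rule sq)
    show "(\<integral>x. x \<partial>D) = 0" using assms(6) by (simp add: D_def integral_distr)
    show "(\<integral>x. x\<^sup>2 \<partial>D) = \<sigma>\<^sup>2" using assms(6,8) by (simp add: D_def integral_distr)
  qed
  have window: "window_sum Xs n (real n / ln (real n) powr p) \<omega> =
      (\<Sum>i\<in>{n..<n + window_size p n}. Z i \<omega>)" for n \<omega>
    unfolding window_sum_def window_size_def window_length_def[symmetric] Z_def
    using sum.shift_bounds_Suc_ivl[of "\<lambda>j. Xs j \<omega>" n "n + nat \<lfloor>window_length p n\<rfloor>"]
    by (simp add: atLeastLessThanSuc_atLeastAtMost)
  define W where "W n \<omega> = (\<Sum>i\<in>{n..<n + window_size p n}. Z i \<omega>) / norming p n" for n \<omega>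
  have d_pos: "eventually (\<lambda>n. norming p n > 0) sequentially"
    using norming_at_top[OF assms(10)] by (simp add: filterlim_at_top_dense)
  have upper: "AE \<omega> in M. \<forall>k::nat. eventually (\<lambda>n. \<bar>W n \<omega>\<bar> \<le> \<sigma> + 1 / real (Suc k)) sequentially"
    unfolding AE_all_countable
  proof
    fix k
    have "AE \<omega> in M. \<forall>\<^sub>F n in sequentially. \<bar>\<Sum>i\<in>{n..<n + window_size p n}. Z i \<omega>\<bar> \<le>
        (\<sigma> + 1 / real (Suc k)) * norming p n"
      by (rule window_upper_bound[OF assms(10) mom assms(9)]) simp
    then show "AE \<omega> in M. eventually (\<lambda>n. \<bar>W n \<omega>\<bar> \<le> \<sigma> + 1 / real (Suc k)) sequentially"
    proof eventually_elim
      case (elim \<omega>)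
      from elim d_pos show ?case by eventually_elim (simp add: W_def field_simps)
    qed
  qed
  have lower: "AE \<omega> in M. \<forall>k::nat. frequently (\<lambda>n. W n \<omega> \<ge>
      \<sigma> - \<sigma> / real (k + 2)) sequentially" if \<sigma>: "\<sigma> > 0"
    unfolding AE_all_countable
  proof
    fix k
    have "AE \<omega> in M. \<exists>\<^sub>F n in sequentially. (\<sigma> - \<sigma> / real (k + 2)) * norming p n \<le>
        (\<Sum>i\<in>{n..<n + window_size p n}. Z i \<omega>)"
      using \<sigma> by (intro window_lower_bound[OF assms(10)]) (auto simp: field_simps add_pos_nonneg)
    then show "AE \<omega> in M. frequently (\<lambda>n. W n \<omega> \<ge> \<sigma> - \<sigma> / real (k + 2)) sequentially"
    proof eventually_elim
      case (elim \<omega>)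
      from frequently_eventually_frequently[OF elim d_pos] show ?case
        by (rule frequently_elim1) (simp add: W_def pos_le_divide_eq)
    qed
  qed
  \<comment> \<open>A vanishing \<open>\<sigma>\<close> leaves no threshold between 0 and \<open>\<sigma>\<close>; in that case the two-sided upper bound
    already forces the normed window sums to tend to 0.\<close>
  have "AE \<omega> in M. limsup (\<lambda>n. ereal (W n \<omega>)) \<ge> ereal \<sigma>"
  proof (cases "\<sigma> > 0")
    case True
    from lower[OF True] show ?thesis
    proof eventually_elim
      case (elim \<omega>)
      have le: "ereal (\<sigma> - \<sigma> / real (k + 2)) \<le> limsup (\<lambda>n. ereal (W n \<omega>))" for k
      proof (rule ccontr)
        assume "\<not> ereal (\<sigma> - \<sigma> / real (k + 2)) \<le> limsup (\<lambda>n. ereal (W n \<omega>))"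
        then have "eventually (\<lambda>n. ereal (W n \<omega>) < ereal (\<sigma> - \<sigma> / real (k + 2))) sequentially"
          by (intro Limsup_lessD) simp
        with elim[THEN spec, of k] show False
          by (simp add: frequently_def not_le)
      qed
      have lim: "(\<lambda>k. ereal (\<sigma> - \<sigma> / real (k + 2))) \<longlonglongrightarrow> ereal \<sigma>"
        unfolding lim_ereal by real_asymp
      show ?case by (rule LIMSEQ_le_const2[OF lim]) (use le in blast)
    qed
  next
    case False
    then have \<sigma>0: "\<sigma> = 0" using assms(9) by simp
    from upper show ?thesis
    proof eventually_elim
      case (elim \<omega>)
      have le: "ereal (- (1 / real (Suc k))) \<le> limsup (\<lambda>n. ereal (W n \<omega>))" for k
      proof (rule le_Limsup)
        show "eventually (\<lambda>n. ereal (- (1 / real (Suc k))) \<le> ereal (W n \<omega>)) sequentially"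
          using elim[THEN spec, of k] by eventually_elim (auto simp: \<sigma>0)
      qed simp
      have lim: "(\<lambda>k. ereal (- (1 / real (Suc k)))) \<longlonglongrightarrow> ereal 0"
        unfolding lim_ereal by real_asymp
      show ?case unfolding \<sigma>0 by (rule LIMSEQ_le_const2[OF lim]) (use le in blast)
    qed
  qed
  with upper have "AE \<omega> in M. limsup (\<lambda>n. ereal (W n \<omega>)) = ereal \<sigma>"
  proof eventually_elim
    case (elim \<omega>)
    have le: "limsup (\<lambda>n. ereal (W n \<omega>)) \<le> ereal (\<sigma> + 1 / real (Suc k))" for k
    proof (rule Limsup_bounded)
      show "eventually (\<lambda>n. ereal (W n \<omega>) \<le> ereal (\<sigma> + 1 / real (Suc k))) sequentially"
        using elim(1)[THEN spec, of k] by eventually_elim auto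
    qed
    have lim: "(\<lambda>k. ereal (\<sigma> + 1 / real (Suc k))) \<longlonglongrightarrow> ereal \<sigma>"
      unfolding lim_ereal by real_asymp
    have "limsup (\<lambda>n. ereal (W n \<omega>)) \<le> ereal \<sigma>"
      by (rule LIMSEQ_le_const[OF lim]) (use le in blast)
    then show ?case using elim(2) by (rule antisym)
  qed
  then show ?thesis
    unfolding window W_def norming_def window_length_def .
qed

end
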